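(* Let $a>0$ and for $b,c>0$ put $\Phi(x)={}_1F_2\left(a\,;b,c\,;-\frac{x^2}{4}\right)$. Let $\Lambda=\left\{\left(a+\frac12,\,2a\right),\,\left(2a,\,a+\frac12\right)\right\}$ and let $P_a$ be the Newton diagram associated to $\Lambda$, i.e. the convex hull of $\bigcup_{(\alpha,\beta)\in\Lambda}\{(x,y)\in\mathbb{R}^2: x\ge\alpha,\ y\ge\beta\}$. Let $O_a\subset(0,\infty)^2$ be the set of points $(b,c)$ defined as follows: if $a\ge\frac12$, $$O_a=\left\{(b,c): a<b<a+\tfrac12,\ c\ge 3a+\tfrac12-b\right\}\cup\left\{(b,c): 2a<b<2a+\tfrac12,\ 3a+\tfrac12-b\le c<a+\tfrac12\right\}\cup\left\{(b,c): b\ge 2a+\tfrac12,\ a<c<a+\tfrac12\right\};$$ if $0<a<\frac12$, $$O_a=\left\{(b,c): a<b<2a,\ c\ge 3a+\tfrac12-b\right\}\cup\left\{(b,c): a+\tfrac12<b<2a+\tfrac12,\ 3a+\tfrac12-b\le c<2a\right\}\cup\left\{(b,c): b\ge 2a+\tfrac12,\ a<c<2a\right\}.$$ Let $N_a$ be the complement of $P_a\cup O_a$ in $(0,\infty)^2$. Then: (i) If $(b,c)\in P_a$, then $\Phi(x)\ge0$ for all $x>0$, and $\Phi(x)>0$ for all $x>0$ unless $(b,c)\in\Lambda$. (ii) If $(b,c)\in N_a$, then $\Phi$ alternates in sign and possesses at least one zero on $(0,\infty)$.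
   Context: For $a,b,c>0$, ${}_1F_2\left(a\,;b,c\,;-\frac{x^2}{4}\right)=\sum_{k=0}^\infty \frac{(a)_k}{k!\,(b)_k(c)_k}\left(-\frac{x^2}{4}\right)^k$, where $(\alpha)_k=\Gamma(\alpha+k)/\Gamma(\alpha)$. "Alternates in sign" means takes both positive and negative values on $(0,\infty)$. *)

theory Defs
  imports "HOL-Analysis.Analysis"
begin

definition hyp1F2 :: "real \<Rightarrow> real \<Rightarrow> real \<Rightarrow> real \<Rightarrow> real" where
  "hyp1F2 a b c z =
     (\<Sum>k. pochhammer a k / (fact k * pochhammer b k * pochhammer c k) * z ^ k)"

definition Lam :: "real \<Rightarrow> (real \<times> real) set" where
  "Lam a = {(a + 1/2, 2*a), (2*a, a + 1/2)}"

definition newton_diagram :: "(real \<times> real) set \<Rightarrow> (real \<times> real) set" where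
  "newton_diagram L = convex hull (\<Union>(\<alpha>, \<beta>)\<in>L. {(x, y). x \<ge> \<alpha> \<and> y \<ge> \<beta>})"

definition Oset :: "real \<Rightarrow> (real \<times> real) set" where
  "Oset a =
    (if a \<ge> 1/2 then
       {(b, c). a < b \<and> b < a + 1/2 \<and> c \<ge> 3*a + 1/2 - b}
     \<union> {(b, c). 2*a < b \<and> b < 2*a + 1/2 \<and> 3*a + 1/2 - b \<le> c \<and> c < a + 1/2}
     \<union> {(b, c). b \<ge> 2*a + 1/2 \<and> a < c \<and> c < a + 1/2}
     else
       {(b, c). a < b \<and> b < 2*a \<and> c \<ge> 3*a + 1/2 - b}
     \<union> {(b, c). a + 1/2 < b \<and> b < 2*a + 1/2 \<and> 3*a + 1/2 - b \<le> c \<and> c < 2*a}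
     \<union> {(b, c). b \<ge> 2*a + 1/2 \<and> a < c \<and> c < 2*a})"

definition Nset :: "real \<Rightarrow> (real \<times> real) set" where
  "Nset a = {(b, c). b > 0 \<and> c > 0} - (newton_diagram (Lam a) \<union> Oset a)"

end

theory Submission
  imports Defs "HOL-Complex_Analysis.Complex_Analysis"
begin

text \<open>
  Write \<open>F(r) = 1F2(a; b, c; -r)\<close> with \<open>r = x\<^sup>2/4\<close>.

  (i) On the segment joining the two points of \<open>\<Lambda>\<close> one has \<open>b + c = 3 a + 1/2\<close>, and \<open>F\<close> expands into
  squares of Bessel functions of order \<open>a - 1/2 + n\<close> with nonnegative coefficients, which are positive
  in the interior of the segment; the squares do not vanish simultaneously. Every other point of \<open>P\<^sub>a\<close>
  lies above the segment, and a Beta integral of \<open>F\<close> raises a lower parameter, turning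
  nonnegativity into positivity.

  (ii) On \<open>N\<^sub>a\<close> one has \<open>b \<le> a\<close> or \<open>c \<le> a\<close> or \<open>b + c < 3 a + 1/2\<close>. Suppose that \<open>F \<ge> 0\<close>.
  If \<open>c \<le> a\<close>, raise \<open>c\<close> to \<open>a\<close>: the Laplace transform of \<open>r powr (b - 1) * F(r)\<close> is then a multiple of
  \<open>s powr (-b) * exp (-1/s)\<close>, which is not monotone. If \<open>a < c \<le> b\<close>, the same transform shows that the
  moments of \<open>F\<close> of order less than \<open>a\<close> are finite, so the transform \<open>L\<close> of \<open>r powr (b - 1) * F(r)\<close> against
  \<open>exp (-2 s sqrt r)\<close> is holomorphic for \<open>Re s > 0\<close> and at most of order \<open>(Re s) powr (-2 (b - q))\<close> for each
  \<open>q < a\<close>. On the other hand \<open>L(s)\<close> is a multiple of \<open>s powr (-2 b) * 2F1(a, b + 1/2; c; -1/s\<^sup>2)\<close>, which at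
  \<open>s = \<i>\<close> has a singularity of order \<open>a + b + 1/2 - c\<close>. Comparing the two orders gives
  \<open>b + c \<ge> 3 a + 1/2\<close>.
\<close>

subsection \<open>Squares of Bessel functions\<close>

text \<open>Up to elementary factors, the coefficients in Gasper's expansion of \<^term>\<open>hyp1F2 a b c\<close>
  into squares of Bessel functions on the line \<open>b + c = 3 a + 1/2\<close>. For \<open>n = 0\<close> the general formula
  would read \<open>(2 a - 1) / (2 a - 1)\<close>.\<close>

definition gasper_coeff :: "real \<Rightarrow> real \<Rightarrow> real \<Rightarrow> nat \<Rightarrow> real" where
  "gasper_coeff a b c n =
     (if n = 0 then 1
      else (2 * real n + 2 * a - 1) * pochhammer (2 * a) (n - 1) / fact n *
        (pochhammer (2 * a - b) n * pochhammer (b - a - 1/2) n) /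
        (pochhammer b n * pochhammer c n))"

text \<open>The terminating very-well-poised \<open>5F4\<close> sum, proved with a Wilf-Zeilberger certificate:
  \<open>g\<close> below is the companion of the summand \<open>T\<close>.\<close>

lemma gasper_coeff_sum:
  fixes a b c :: real
  assumes pos: "a > 0" "b > 0" "c > 0" and bc: "b + c = 3 * a + 1/2"
  shows "(\<Sum>n\<le>m. (-1) ^ n * gasper_coeff a b c n / (fact (m - n) * pochhammer (2 * a) (m + n))) =
         pochhammer (a + 1/2) m / (fact m * pochhammer b m * pochhammer c m)"
proof -
  define T where "T = (\<lambda>m n. (-1) ^ n * gasper_coeff a b c n /
    (fact (m - n) * pochhammer (2 * a) (m + n)))"
  \<comment> \<open>\<open>e n\<close> is the coefficient with its factor (2 n + 2 a - 1) / (n + 2 a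
    - 1) removed; consecutive values have a rational ratio with linear factors. \<open>H n\<close>
    is the certificate times \<open>e n\<close>, written through the preceding value of
    \<open>e\<close>, so that there is no division by n + 2 a - 1, which vanishes for n = 0 and a =
    1/2.\<close>
  define e where "e = (\<lambda>n. pochhammer (2 * a) n / fact n *
    (pochhammer (2 * a - b) n * pochhammer (b - a - 1/2) n) / (pochhammer b n * pochhammer c n))"
  define H where "H = (\<lambda>n. case n of 0 \<Rightarrow> 0
     | Suc k \<Rightarrow> e k * (2 * a - b + real k) * (b - a - 1/2 + real k))"
  \<comment> \<open>The quotient of consecutive right-hand sides. The claim thus becomes a
    first-order recurrence in m with multiplier \<open>q m\<close>.\<close>
  define q where "q = (\<lambda>m. (a + 1/2 + real m) / ((real m + 1) * (b + real m) * (c + real m)))"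
  define g where "g = (\<lambda>m n. - H n * (-1) ^ n / (fact (m + 1 - n) * pochhammer (2 * a) (m + n)) /
    ((real m + 1) * (b + real m) * (c + real m)))"
  have c: "c = 3 * a + 1/2 - b" using bc by simp
  have ppos: "pochhammer (2 * a) n > 0" "pochhammer b n > 0" "pochhammer c n > 0" for n
    using pos by (auto intro: pochhammer_pos)
  have C_e: "gasper_coeff a b c n * (real n + 2 * a - 1) = (2 * real n + 2 * a - 1) * e n"
    if n0: "n > 0" for n
  proof -
    obtain k where [simp]: "n = Suc k" using n0 by (cases n) auto
    have "pochhammer (2 * a) n = pochhammer (2 * a) k * (2 * a + real k)"
      by (simp add: pochhammer_Suc)
    thus ?thesis by (simp add: gasper_coeff_def e_def)
  qed
  have H_e: "H n * (real n + 2 * a - 1) = real n * (b + real n - 1) * (c + real n - 1) * e n"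
    if n0: "n > 0" for n
  proof -
    obtain k where n: "n = Suc k" using n0 by (cases n) auto
    have nz: "b + real k > 0" "c + real k > 0" using pos by auto
    define R S where "R = (2 * a + real k) * ((2 * a - b + real k) * (b - a - 1/2 + real k))"
      and "S = (real k + 1) * (b + real k) * (c + real k)"
    have "e (Suc k) = e k * (R / S)"
      unfolding e_def pochhammer_Suc fact_Suc R_def S_def by (simp add: mult_ac add_ac)
    moreover have "S > 0" using nz by (simp add: S_def)
    ultimately have "e (Suc k) * S = e k * R" by simp
    moreover have "H n = e k * (2 * a - b + real k) * (b - a - 1/2 + real k)" "real n = real k + 1"
      by (simp_all add: n H_def)
    ultimately show ?thesis unfolding R_def S_def n by algebra
  qed
  \<comment> \<open>The Wilf-Zeilberger equation cleared of factorials. For n = 0, where the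
    coefficient and \<open>H\<close> take special values, it is a polynomial identity; for n > 0 it
    is multiplied by n + 2 a - 1 > 0 and reduced to \<open>C_e\<close> and
    \<open>H_e\<close>.\<close>
  have key: "gasper_coeff a b c n * ((real m + 1) * (b + real m) * (c + real m)
        - (a + 1/2 + real m) * (real k + 1) * (2 * a + real m + real n)) =
      H (Suc n) * (real k + 1) + H n * (2 * a + real m + real n)" if m: "m = n + k" for m n k
  proof (cases "n = 0")
    case True
    have "(x + 1) * (b + x) * (3 * a + 1/2 - b + x) - (a + 1/2 + x) * (x + 1) * (2 * a + x) =
        (2 * a - b) * (b - a - 1/2) * (x + 1)" for x
      by (simp add: field_simps)
    thus ?thesis using True m by (simp add: H_def e_def gasper_coeff_def c)
  next
    case False
    define N where "N = real n"
    have N: "N + 2 * a - 1 > 0" using False pos unfolding N_def by (cases n) auto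
    have 1: "gasper_coeff a b c n * (N + 2 * a - 1) = (2 * N + 2 * a - 1) * e n"
      using C_e[of n] False by (simp add: N_def)
    have 2: "H n * (N + 2 * a - 1) = N * (b + N - 1) * (c + N - 1) * e n"
      using H_e[of n] False by (simp add: N_def)
    have 3: "H (Suc n) = e n * (2 * a - b + N) * (b - a - 1/2 + N)" by (simp add: H_def N_def)
    have M: "real m = N + real k" using m by (simp add: N_def)
    have "(N + 2 * a - 1) * (gasper_coeff a b c n * ((real m + 1) * (b + real m) * (c + real m)
        - (a + 1/2 + real m) * (real k + 1) * (2 * a + real m + real n))) =
        (N + 2 * a - 1) * (H (Suc n) * (real k + 1) + H n * (2 * a + real m + real n))"
      using 1 2 unfolding 3 M c N_def[symmetric] by algebra
    thus ?thesis using N by simp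
  qed
  have step: "T (Suc m) n - q m * T m n = g m (Suc n) - g m n" if nm: "n \<le> m" for m n
  proof -
    obtain k where m: "m = n + k" using nm le_Suc_ex by blast
    define Q where "Q = (real m + 1) * (b + real m) * (c + real m)"
    define P where "P = pochhammer (2 * a) (m + n)"
    define s where "s = 2 * a + real m + real n"
    have nz: "Q > 0" "P > 0" "s > 0"
      using pos ppos by (auto simp: Q_def P_def s_def)
    have P1: "pochhammer (2 * a) (Suc (m + n)) = P * s"
      by (simp add: pochhammer_Suc P_def s_def)
    have f1: "fact (Suc m - n) = (real k + 1) * fact k" by (simp add: m Suc_diff_le)
    have T1: "T (Suc m) n = (-1) ^ n * gasper_coeff a b c n / ((real k + 1) * fact k * (P * s))"
      unfolding T_def using f1 P1 by simp
    have T2: "T m n = (-1) ^ n * gasper_coeff a b c n / (fact k * P)"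
      unfolding T_def P_def by (simp add: m)
    have g1: "g m (Suc n) = H (Suc n) * (-1) ^ n / (fact k * (P * s)) / Q"
      unfolding g_def Q_def using P1 by (simp add: m)
    have g2: "g m n = - H n * (-1) ^ n / ((real k + 1) * fact k * P) / Q"
      unfolding g_def Q_def P_def using f1 by (simp add: m)
    have q: "q m = (a + 1/2 + real m) / Q" by (simp add: q_def Q_def)
    have key': "gasper_coeff a b c n * (Q - (a + 1/2 + real m) * (real k + 1) * s) =
      H (Suc n) * (real k + 1) + H n * s"
      using key[OF m] by (simp add: Q_def s_def)
    have k1: "real k + 1 > 0" by simp
    have "T (Suc m) n - q m * T m n =
        (-1) ^ n / (fact k * P) / ((real k + 1) * s * Q) *
        (gasper_coeff a b c n * (Q - (a + 1/2 + real m) * (real k + 1) * s))"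
      unfolding T1 T2 q using nz k1 by (simp add: divide_simps) (simp add: algebra_simps)
    also have "\<dots> = g m (Suc n) - g m n"
      unfolding g1 g2 key' using nz k1 by (simp add: divide_simps) (simp add: algebra_simps)
    finally show ?thesis .
  qed
  \<comment> \<open>The term n = m + 1 of row m + 1 has no partner in row m; it cancels the boundary
    term left by telescoping.\<close>
  have last: "T (Suc m) (Suc m) = - g m (Suc m)" for m
  proof -
    define P where "P = pochhammer (2 * a) (m + Suc m)"
    have pp: "pochhammer (2 * a) (Suc m + Suc m) = P * (2 * a + real (2 * m + 1))"
      by (simp add: P_def pochhammer_Suc)
    define Q where "Q = (real m + 1) * (b + real m) * (c + real m)"
    have Q: "Q > 0" using pos by (simp add: Q_def)
    have s: "2 * a + real (2 * m + 1) > 0" "real (Suc m) + 2 * a - 1 > 0" using pos by auto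
    have "(real (Suc m) + 2 * a - 1) * (gasper_coeff a b c (Suc m) * Q) =
       (real (Suc m) + 2 * a - 1) * (H (Suc m) * (2 * a + real (2 * m + 1)))"
    proof -
      have 1: "gasper_coeff a b c (Suc m) * (real (Suc m) + 2 * a - 1) =
          (2 * a + real (2 * m + 1)) * e (Suc m)"
        using C_e[of "Suc m"] by (simp add: algebra_simps)
      have "Q = real (Suc m) * (b + real (Suc m) - 1) * (c + real (Suc m) - 1)"
        by (simp add: Q_def add_ac)
      hence 2: "H (Suc m) * (real (Suc m) + 2 * a - 1) = Q * e (Suc m)"
        using H_e[of "Suc m"] by simp
      have "(real (Suc m) + 2 * a - 1) * (gasper_coeff a b c (Suc m) * Q) =
          (2 * a + real (2 * m + 1)) * e (Suc m) * Q"
        unfolding 1[symmetric] by (simp only: mult_ac)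
      also have "\<dots> = (2 * a + real (2 * m + 1)) * (Q * e (Suc m))" by (simp only: mult_ac)
      also have "\<dots> = (real (Suc m) + 2 * a - 1) * (H (Suc m) * (2 * a + real (2 * m + 1)))"
        unfolding 2[symmetric] by (simp only: mult_ac)
      finally show ?thesis .
    qed
    hence eq: "gasper_coeff a b c (Suc m) * Q = H (Suc m) * (2 * a + real (2 * m + 1))"
      using s by simp
    have "T (Suc m) (Suc m) =
        (-1) ^ Suc m * gasper_coeff a b c (Suc m) / (P * (2 * a + real (2 * m + 1)))"
      unfolding T_def pp by simp
    also have "\<dots> = (-1) ^ Suc m * (gasper_coeff a b c (Suc m) * Q) /
        (P * (2 * a + real (2 * m + 1)) * Q)"
      using Q by simp
    also have "\<dots> = (-1) ^ Suc m * H (Suc m) / P / Q"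
      unfolding eq using s by simp
    also have "\<dots> = - g m (Suc m)"
      unfolding g_def Q_def[symmetric] P_def[symmetric] by simp
    finally show ?thesis .
  qed
  have "(\<Sum>n\<le>m. T m n) = pochhammer (a + 1/2) m / (fact m * pochhammer b m * pochhammer c m)"
  proof (induction m)
    case 0
    show ?case by (simp add: T_def gasper_coeff_def)
  next
    case (Suc m)
    have "(\<Sum>n\<le>m. T (Suc m) n) - q m * (\<Sum>n\<le>m. T m n) = (\<Sum>n\<le>m. g m (Suc n) - g m n)"
      by (simp add: sum_distrib_left sum_subtractf[symmetric] step)
    also have "\<dots> = g m (Suc m) - g m 0"
      using sum_telescope[of "\<lambda>n. - g m n" m] by (simp add: sum_negf[symmetric])
    also have "g m 0 = 0" by (simp add: g_def H_def)
    finally have "(\<Sum>n\<le>Suc m. T (Suc m) n) = q m * (\<Sum>n\<le>m. T m n)"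
      using last[of m] by simp
    also have "\<dots> = pochhammer (a + 1/2) (Suc m) / (fact (Suc m) * pochhammer b (Suc m) * pochhammer c (Suc m))"
      unfolding Suc.IH q_def by (simp add: pochhammer_Suc mult_ac add_ac)
    finally show ?case .
  qed
  thus ?thesis by (simp add: T_def)
qed

text \<open>For x > 0, \<open>hyp0F1 d (- x^2 / 4)\<close> is a constant multiple of x^(1 - d) J(x),
  with J the Bessel function of order d - 1. The argument - r / 4 with r = x^2 / 4 therefore belongs
  to J at x / 2.\<close>

definition hyp0F1 :: "real \<Rightarrow> real \<Rightarrow> real" where
  "hyp0F1 d z = (\<Sum>k. z ^ k / (fact k * pochhammer d k))"

text \<open>The sum is the coefficient of z^k in the square of the series 0F1. Multiplied by (d)_k^2
  it is a Vandermonde convolution of generalized binomial coefficients with upper entry d + k -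
  1.\<close>

lemma bessel_square_coeff:
  fixes d :: real
  assumes "d > 0"
  shows "(\<Sum>j\<le>k. 1 / (fact j * pochhammer d j) * (1 / (fact (k - j) * pochhammer d (k - j)))) =
         pochhammer (2 * d - 1 + real k) k / (fact k * (pochhammer d k)\<^sup>2)"
proof -
  define x where "x = d + real k - 1"
  have ppos: "pochhammer d j > 0" for j using assms by (rule pochhammer_pos)
  have gb: "x gchoose i = pochhammer d k / (pochhammer d (k - i) * fact i)" if "i \<le> k" for i
  proof -
    have "x gchoose i = pochhammer (x - real i + 1) i / fact i"
      by (rule gbinomial_pochhammer')
    also have "x - real i + 1 = d + real (k - i)" using that by (simp add: x_def of_nat_diff)
    also have "pochhammer (d + real (k - i)) i = pochhammer d k / pochhammer d (k - i)"
      using pochhammer_product[of "k - i" k d] that ppos[of "k - i"] by (simp add: field_simps)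
    finally show ?thesis by simp
  qed
  have "(\<Sum>j\<le>k. 1 / (fact j * pochhammer d j) * (1 / (fact (k - j) * pochhammer d (k - j)))) =
        (\<Sum>j\<le>k. (x gchoose j) * (x gchoose (k - j))) / (pochhammer d k)\<^sup>2"
    unfolding sum_divide_distrib
    by (intro sum.cong refl) (use ppos[of k] in \<open>simp add: gb power2_eq_square field_simps\<close>)
  also have "(\<Sum>j\<le>k. (x gchoose j) * (x gchoose (k - j))) = (x + x) gchoose k"
    using gbinomial_Vandermonde[of x x k] by (simp add: atLeast0AtMost)
  also have "\<dots> = pochhammer (2 * d - 1 + real k) k / fact k"
    by (subst gbinomial_pochhammer') (simp add: x_def algebra_simps)
  finally show ?thesis by simp
qed

section \<open>Convergence and continuity of the hypergeometric series\<close>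

lemma summable_hyp1F1:
  fixes a c R :: real
  assumes "a > 0" "c > 0" "R \<ge> 0"
  shows "summable (\<lambda>k. pochhammer a k / (fact k * pochhammer c k) * R ^ k)"
proof -
  define M where "M = 1 + a / c"
  have M: "a + real k \<le> M * (c + real k)" for k
    using assms by (simp add: M_def field_simps)
  obtain N :: nat where N: "2 * (M * R) \<le> real N" using real_arch_simple by blast
  show ?thesis
  proof (rule summable_ratio_test[of "1/2" N])
    fix k assume k: "N \<le> k"
    define t where "t = pochhammer a k / (fact k * pochhammer c k) * R ^ k"
    have t: "t \<ge> 0" using assms unfolding t_def
      by (intro mult_nonneg_nonneg divide_nonneg_nonneg) (auto intro: pochhammer_nonneg)
    have "pochhammer a (Suc k) / (fact (Suc k) * pochhammer c (Suc k)) * R ^ Suc k =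
          t * ((a + real k) * R / ((real k + 1) * (c + real k)))"
      by (simp add: t_def pochhammer_Suc mult_ac add_ac)
    also have "\<dots> \<le> t * (1/2)"
    proof (intro mult_left_mono t)
      have "(a + real k) * R \<le> M * (c + real k) * R"
        using M assms by (intro mult_right_mono) auto
      hence "2 * ((a + real k) * R) \<le> (2 * (M * R)) * (c + real k)" by (simp add: algebra_simps)
      also have "\<dots> \<le> (real k + 1) * (c + real k)"
        using N k assms by (intro mult_right_mono) auto
      finally show "(a + real k) * R / ((real k + 1) * (c + real k)) \<le> 1/2"
        using assms by (simp add: divide_le_eq)
    qed
    finally have "pochhammer a (Suc k) / (fact (Suc k) * pochhammer c (Suc k)) * R ^ Suc k \<le> t * (1/2)" .
    moreover have "pochhammer a (Suc k) / (fact (Suc k) * pochhammer c (Suc k)) * R ^ Suc k \<ge> 0"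
      using assms
      by (intro mult_nonneg_nonneg divide_nonneg_nonneg) (auto intro: pochhammer_nonneg)
    ultimately show "norm (pochhammer a (Suc k) / (fact (Suc k) * pochhammer c (Suc k)) * R ^ Suc k)
       \<le> 1/2 * norm (pochhammer a k / (fact k * pochhammer c k) * R ^ k)"
      unfolding t_def[symmetric] real_norm_def using t by (simp only: abs_of_nonneg mult.commute)
  qed auto
qed

lemma pochhammer_Suc_ge:
  fixes b :: real
  assumes "b > 0"
  shows "pochhammer b (Suc n) \<ge> b"
proof (induction n)
  case (Suc n)
  have "b * 1 \<le> pochhammer b (Suc n) * (b + real (Suc n))"
    using Suc assms by (intro mult_mono) auto
  thus ?case by (simp only: pochhammer_Suc[of b "Suc n"] mult_1_right)
qed auto

lemma pochhammer_ge_min: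
  fixes b :: real
  assumes "b > 0"
  shows "pochhammer b k \<ge> min 1 b"
  using pochhammer_Suc_ge[OF assms] by (cases k) (auto simp: min.coboundedI2)

lemma summable_hyp1F2:
  fixes a b c R :: real
  assumes "a > 0" "b > 0" "c > 0" "R \<ge> 0"
  shows "summable (\<lambda>k. pochhammer a k / (fact k * pochhammer b k * pochhammer c k) * R ^ k)"
proof (rule summable_comparison_test)
  show "summable (\<lambda>k. pochhammer a k / (fact k * pochhammer c k) * R ^ k * (1 / min 1 b))"
    using summable_hyp1F1[of a c R] assms by (intro summable_mult2) auto
  show "\<exists>N. \<forall>k\<ge>N. norm (pochhammer a k / (fact k * pochhammer b k * pochhammer c k) * R ^ k)
      \<le> pochhammer a k / (fact k * pochhammer c k) * R ^ k * (1 / min 1 b)"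
  proof (intro exI allI impI)
    fix k
    have pp: "pochhammer a k > 0" "pochhammer b k > 0" "pochhammer c k > 0"
      using assms by (auto intro: pochhammer_pos)
    have "norm (pochhammer a k / (fact k * pochhammer b k * pochhammer c k) * R ^ k) =
        pochhammer a k / (fact k * pochhammer c k) * R ^ k * (1 / pochhammer b k)"
      using pp assms by (simp add: mult_ac)
    also have "\<dots> \<le> pochhammer a k / (fact k * pochhammer c k) * R ^ k * (1 / min 1 b)"
      using pp assms pochhammer_ge_min[of b k]
      by (intro mult_left_mono divide_left_mono mult_pos_pos mult_nonneg_nonneg divide_nonneg_nonneg)
        auto
    finally show "norm (pochhammer a k / (fact k * pochhammer b k * pochhammer c k) * R ^ k)
      \<le> pochhammer a k / (fact k * pochhammer c k) * R ^ k * (1 / min 1 b)" .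
  qed
qed

lemma summable_abs_hyp1F2:
  fixes a b c z :: real
  assumes "a > 0" "b > 0" "c > 0"
  shows "summable (\<lambda>k. \<bar>pochhammer a k / (fact k * pochhammer b k * pochhammer c k) * z ^ k\<bar>)"
proof -
  have "pochhammer x k \<ge> 0" if "x > 0" for x :: real and k
    using pochhammer_pos[OF that, of k] by simp
  thus ?thesis
    using summable_hyp1F2[OF assms, of "\<bar>z\<bar>"] assms
    by (simp add: abs_mult power_abs del: fact_Suc)
qed

lemma hyp1F2_sums:
  fixes a b c z :: real
  assumes "a > 0" "b > 0" "c > 0"
  shows "(\<lambda>k. pochhammer a k / (fact k * pochhammer b k * pochhammer c k) * z ^ k)
           sums hyp1F2 a b c z"
  unfolding hyp1F2_def
  by (rule summable_sums, rule summable_rabs_cancel, rule summable_abs_hyp1F2[OF assms])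

lemma hyp1F2_commute: "hyp1F2 a b c z = hyp1F2 a c b z"
  by (simp add: hyp1F2_def mult_ac)

lemma continuous_hyp1F2:
  fixes a b c :: real
  assumes "a > 0" "b > 0" "c > 0"
  shows "continuous_on A (hyp1F2 a b c)"
proof (rule continuous_at_imp_continuous_on, rule ballI)
  fix x
  show "isCont (hyp1F2 a b c) x"
    unfolding hyp1F2_def
    by (rule isCont_powser[of _ "\<bar>x\<bar> + 1"])
       (use hyp1F2_sums[OF assms, of "\<bar>x\<bar> + 1"] in \<open>auto simp: sums_iff\<close>)
qed

lemma hyp1F2_0 [simp]: "hyp1F2 a b c 0 = 1"
  unfolding hyp1F2_def by (subst powser_zero) simp

text \<open>0F1 is the 1F2 with upper parameter 1 and lower parameters d and 1, whose two factors
  (1)_k cancel.\<close>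

lemma summable_abs_hyp0F1:
  fixes d z :: real
  assumes "d > 0"
  shows "summable (\<lambda>k. norm (z ^ k / (fact k * pochhammer d k)))"
proof -
  have "pochhammer (1::real) k \<noteq> 0" for k by (simp add: pochhammer_fact[symmetric])
  thus ?thesis
    using summable_abs_hyp1F2[of 1 d 1 z] assms by (simp add: pochhammer_fact[symmetric])
qed

lemma hyp0F1_square_sums:
  fixes d z :: real
  assumes "d > 0"
  shows "(\<lambda>k. pochhammer (2 * d - 1 + real k) k / (fact k * (pochhammer d k)\<^sup>2) * z ^ k)
           sums (hyp0F1 d z)\<^sup>2"
proof -
  have "(\<lambda>k. \<Sum>i\<le>k. z ^ i / (fact i * pochhammer d i) * (z ^ (k - i) / (fact (k - i) * pochhammer d (k - i))))
     sums (hyp0F1 d z * hyp0F1 d z)"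
    unfolding hyp0F1_def using assms by (intro Cauchy_product_sums summable_abs_hyp0F1)
  moreover have "(\<Sum>i\<le>k. z ^ i / (fact i * pochhammer d i) *
      (z ^ (k - i) / (fact (k - i) * pochhammer d (k - i)))) =
     pochhammer (2 * d - 1 + real k) k / (fact k * (pochhammer d k)\<^sup>2) * z ^ k" for k
  proof -
    have "(\<Sum>i\<le>k. z ^ i / (fact i * pochhammer d i) *
        (z ^ (k - i) / (fact (k - i) * pochhammer d (k - i)))) =
      (\<Sum>i\<le>k. 1 / (fact i * pochhammer d i) * (1 / (fact (k - i) * pochhammer d (k - i))) * z ^ k)"
      by (intro sum.cong refl) (simp add: power_add[symmetric])
    thus ?thesis
      unfolding sum_distrib_right[symmetric] using bessel_square_coeff[OF assms, of k] by simp
  qed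
  ultimately show ?thesis by (simp add: power2_eq_square)
qed

section \<open>The expansion of 1F2 into squares on the line b + c = 3 a + 1/2\<close>

lemma abs_pochhammer_le:
  fixes x y :: real
  assumes "\<bar>x\<bar> \<le> y"
  shows "\<bar>pochhammer x n\<bar> \<le> pochhammer y n"
proof -
  have "\<bar>pochhammer x n\<bar> = (\<Prod>i\<in>{0..<n}. \<bar>x + real i\<bar>)"
    by (simp add: pochhammer_prod abs_prod)
  also have "\<dots> \<le> (\<Prod>i\<in>{0..<n}. y + real i)"
    using assms by (intro prod_mono) auto
  finally show ?thesis by (simp add: pochhammer_prod)
qed

text \<open>On the line, b - a - 1/2 = 2 a - c. From b, c >= a follow |2 a - b| <= b and |2 a - c|
  <= c, so the quotient of the four Pochhammer symbols is at most 1 in absolute value. The constant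
  compares 2 n + 2 a - 1 with 2 a + n - 1, the factor missing from (2 a)_n.\<close>

lemma gasper_coeff_bound:
  fixes a b c :: real
  assumes "a > 0" "b \<ge> a" "c \<ge> a" and bc: "b + c = 3 * a + 1/2"
  shows "\<bar>gasper_coeff a b c n\<bar> \<le> (2 + 1 / (2 * a)) * (pochhammer (2 * a) n / fact n)"
proof (cases n)
  case 0
  thus ?thesis using assms by (simp add: gasper_coeff_def)
next
  case (Suc k)
  define \<rho> where "\<rho> = pochhammer (2 * a - b) n * pochhammer (b - a - 1/2) n /
        (pochhammer b n * pochhammer c n)"
  have pp: "pochhammer b n > 0" "pochhammer c n > 0" "pochhammer (2 * a) k > 0"
    using assms by (auto intro: pochhammer_pos)
  have "\<bar>pochhammer (2 * a - b) n\<bar> \<le> pochhammer b n" "\<bar>pochhammer (b - a - 1/2) n\<bar> \<le> pochhammer c n"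
    using assms by (auto intro!: abs_pochhammer_le)
  hence "\<bar>pochhammer (2 * a - b) n * pochhammer (b - a - 1/2) n\<bar> \<le> pochhammer b n * pochhammer c n"
    unfolding abs_mult by (intro mult_mono) (use pp in auto)
  hence \<rho>: "\<bar>\<rho>\<bar> \<le> 1" unfolding \<rho>_def using pp by (simp add: abs_mult)
  define D where "D = 2 * a + real k"
  have "2 * real n + 2 * a - 1 \<le> (2 + 1 / (2 * a)) * D"
    using assms unfolding Suc D_def by (simp add: field_simps)
  have "gasper_coeff a b c n = (2 * real n + 2 * a - 1) * pochhammer (2 * a) k / fact n * \<rho>"
    by (simp add: gasper_coeff_def \<rho>_def Suc)
  also have "\<bar>\<dots>\<bar> = (2 * real n + 2 * a - 1) * pochhammer (2 * a) k / fact n * \<bar>\<rho>\<bar>"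
    using assms pp by (simp add: abs_mult Suc)
  also have "\<dots> \<le> (2 * real n + 2 * a - 1) * pochhammer (2 * a) k / fact n * 1"
    using \<rho> pp assms by (intro mult_left_mono) (auto simp: Suc)
  also have "\<dots> \<le> (2 + 1 / (2 * a)) * D * pochhammer (2 * a) k / fact n * 1"
    using \<open>2 * real n + 2 * a - 1 \<le> _\<close> pp
    by (intro mult_right_mono divide_right_mono) auto
  also have "\<dots> = (2 + 1 / (2 * a)) * (pochhammer (2 * a) n / fact n)"
    unfolding Suc pochhammer_Suc D_def by (simp add: mult_ac)
  finally show ?thesis .
qed

text \<open>Insert \<open>gasper_coeff_sum\<close> into every coefficient of 1F2 and exchange the
  two summations, which converge absolutely. For fixed n, the sum over m is the square of a 0F1 by
  \<open>hyp0F1_square_sums\<close>.\<close>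

lemma hyp1F2_sum_of_squares:
  fixes a b c r :: real
  assumes a: "a > 0" and ba: "b \<ge> a" and ca: "c \<ge> a" and bc: "b + c = 3 * a + 1/2" and r: "r \<ge> 0"
  shows "(\<lambda>n. gasper_coeff a b c n * (r / 4) ^ n / (pochhammer (a + 1/2) n)\<^sup>2 *
              (hyp0F1 (a + 1/2 + real n) (- r / 4))\<^sup>2) sums hyp1F2 a b c (- r)"
proof -
  have pos: "b > 0" "c > 0" using a ba ca by auto
  have pp: "pochhammer a n > 0" "pochhammer (2 * a) n > 0" "pochhammer (a + 1/2) n > 0"
    "pochhammer b n > 0" "pochhammer c n > 0" for n
    using a pos by (auto intro: pochhammer_pos)
  define C where "C = gasper_coeff a b c"
  define K where "K = 2 + 1 / (2 * a)"
  have K: "K > 0" using a by (simp add: K_def add_pos_pos)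
  define T where "T = (\<lambda>m n. if n \<le> m then (-r) ^ m * (pochhammer a m / pochhammer (a + 1/2) m) *
     ((-1) ^ n * C n / (fact (m - n) * pochhammer (2 * a) (m + n))) else 0)"
  define S where "S = (\<lambda>n. C n * (r / 4) ^ n / (pochhammer (a + 1/2) n)\<^sup>2 *
      (hyp0F1 (a + 1/2 + real n) (- r / 4))\<^sup>2)"
  have rows: "(\<Sum>n\<le>m. T m n) =
      pochhammer a m / (fact m * pochhammer b m * pochhammer c m) * (-r) ^ m" for m
  proof -
    have "(\<Sum>n\<le>m. T m n) = (-r) ^ m * (pochhammer a m / pochhammer (a + 1/2) m) *
        (pochhammer (a + 1/2) m / (fact m * pochhammer b m * pochhammer c m))"
      unfolding gasper_coeff_sum[OF a pos bc, symmetric] sum_distrib_left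
      by (intro sum.cong) (auto simp: T_def C_def)
    thus ?thesis using pp(3)[of m] by simp
  qed
  \<comment> \<open>By (2 a)_(m+n) >= (2 a)_n (2 a)_m the factor (2 a)_n in the bound of the
    coefficient cancels, and n! (m - n)! forms a binomial coefficient. Row m then sums to at most a
    constant times the m-th term of a 0F1 at 2 r.\<close>
  have T_bound: "\<bar>T m n\<bar> \<le> K * r ^ m * (real (m choose n) / (fact m * pochhammer (2 * a) m))" for m n
  proof (cases "n \<le> m")
    case False
    thus ?thesis using K r pp(2)[of m] by (simp add: T_def)
  next
    case True
    have p1: "pochhammer (2 * a) n * pochhammer (2 * a) m \<le> pochhammer (2 * a) (m + n)"
    proof -
      have "pochhammer (2 * a) m \<le> pochhammer (2 * a + real n) m"
        using abs_pochhammer_le[of "2 * a" "2 * a + real n" m] a by simp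
      hence "pochhammer (2 * a) n * pochhammer (2 * a) m \<le>
          pochhammer (2 * a) n * pochhammer (2 * a + real n) m"
        using pp(2)[of n] by simp
      thus ?thesis using pochhammer_product'[of "2 * a" n m] by (simp add: add.commute)
    qed
    have p2: "pochhammer a m / pochhammer (a + 1/2) m \<le> 1"
      using abs_pochhammer_le[of a "a + 1/2" m] a pp(3)[of m] by simp
    have ch: "real (m choose n) = fact m / (fact n * fact (m - n))"
      using binomial_fact[OF True] by simp
    have "\<bar>T m n\<bar> = r ^ m * (pochhammer a m / pochhammer (a + 1/2) m) *
        (\<bar>C n\<bar> / (fact (m - n) * pochhammer (2 * a) (m + n)))"
      using True r pp(1)[of m] pp(3)[of m] pp(2)[of "m + n"]
      by (simp add: T_def abs_mult power_abs)
    also have "\<dots> \<le> r ^ m * 1 * (K * (pochhammer (2 * a) n / fact n) /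
        (fact (m - n) * (pochhammer (2 * a) n * pochhammer (2 * a) m)))"
      using p1 p2 gasper_coeff_bound[OF a ba ca bc, of n] r pp(1)[of m] pp(3)[of m] pp(2)
      unfolding C_def[symmetric] K_def[symmetric]
      by (intro mult_mono frac_le mult_left_mono)
         (auto intro!: mult_nonneg_nonneg divide_nonneg_nonneg mult_pos_pos less_imp_le[OF pp(2)])
    also have "\<dots> = K * r ^ m * (real (m choose n) / (fact m * pochhammer (2 * a) m))"
      unfolding ch using pp(2)[of n] by simp
    finally show ?thesis .
  qed
  have T_rows: "(\<Sum>n\<le>m. \<bar>T m n\<bar>) \<le> K * ((2 * r) ^ m / (fact m * pochhammer (2 * a) m))" for m
  proof -
    have "(\<Sum>n\<le>m. \<bar>T m n\<bar>) \<le> (\<Sum>n\<le>m. K * r ^ m * (real (m choose n) / (fact m * pochhammer (2 * a) m)))"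
      by (intro sum_mono T_bound)
    also have "\<dots> = K * r ^ m * ((\<Sum>n\<le>m. real (m choose n)) / (fact m * pochhammer (2 * a) m))"
      by (simp add: sum_distrib_left sum_divide_distrib)
    also have "(\<Sum>n\<le>m. real (m choose n)) = 2 ^ m"
      unfolding of_nat_sum[symmetric] choose_row_sum by simp
    finally show ?thesis by (simp add: power_mult_distrib mult_ac)
  qed
  have supp: "T m n = 0" if "n \<notin> {..m}" for m n using that by (auto simp: T_def)
  have row_sum: "((\<lambda>n. \<bar>T m n\<bar>) has_sum (\<Sum>n\<le>m. \<bar>T m n\<bar>)) UNIV" for m
    by (rule has_sum_finite_neutralI[of "{..m}"]) (auto simp: supp)
  have "summable (\<lambda>m. K * ((2 * r) ^ m / (fact m * pochhammer (2 * a) m)))"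
    using summable_abs_hyp0F1[of "2 * a" "2 * r"] a r
    by (intro summable_mult) (simp add: abs_mult abs_of_pos[OF pp(2)])
  hence "summable (\<lambda>m. norm (\<Sum>n\<le>m. \<bar>T m n\<bar>))"
    by (rule summable_comparison_test'[where N = 0]) (use T_rows in \<open>auto simp: abs_of_nonneg[OF sum_nonneg]\<close>)
  hence outer: "(\<lambda>m. \<Sum>n\<le>m. \<bar>T m n\<bar>) summable_on UNIV"
    by (rule norm_summable_imp_summable_on)
  have abs: "(\<lambda>x. norm (case x of (m, n) \<Rightarrow> T m n)) summable_on UNIV \<times> UNIV"
  proof (rule Infinite_Sum.abs_summable_on_Sigma_iff[THEN iffD2], intro conjI ballI)
    fix m :: nat
    show "(\<lambda>n. norm (case (m, n) of (m, n) \<Rightarrow> T m n)) summable_on UNIV"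
      using has_sum_imp_summable[OF row_sum[of m]] by simp
  next
    show "(\<lambda>m. norm (\<Sum>\<^sub>\<infinity>n. norm (case (m, n) of (m, n) \<Rightarrow> T m n))) summable_on UNIV"
      using outer by (simp add: infsumI[OF row_sum] abs_of_nonneg[OF sum_nonneg])
  qed
  hence sumT: "(\<lambda>(m, n). T m n) summable_on UNIV \<times> UNIV"
    by (rule abs_summable_summable)
  have cols: "(\<lambda>m. T m n) sums S n" for n
  proof -
    define d where "d = a + 1/2 + real n"
    have d: "d > 0" using a by (simp add: d_def)
    \<comment> \<open>With m = k + n, the duplication formula for (2 a)_(2 m) rewrites (a)_m / ((a +
      1/2)_m (2 a)_(m+n)) as (2 d - 1 + k)_k / (4^m ((a + 1/2)_m)^2), and (a + 1/2)_m = (a + 1/2)_n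
      (d)_k. This is the shape of the squared 0F1.\<close>
    have eq: "T (k + n) n = C n * (r / 4) ^ n / (pochhammer (a + 1/2) n)\<^sup>2 *
       (pochhammer (2 * d - 1 + real k) k / (fact k * (pochhammer d k)\<^sup>2) * (- r / 4) ^ k)" for k
    proof -
      define A B where "A = pochhammer (a + 1/2) n" and "B = pochhammer d k"
      have AB: "pochhammer (a + 1/2) (k + n) = A * B"
        unfolding A_def B_def d_def using pochhammer_product'[of "a + 1/2" n k]
        by (simp add: add.commute)
      have ABpos: "A > 0" "B > 0" using pp(3) d by (auto simp: A_def B_def intro: pochhammer_pos)
      have idx: "2 * (k + n) = k + n + n + k" by simp
      have "pochhammer (2 * a) (2 * (k + n)) =
         pochhammer (2 * a) (k + n + n) * pochhammer (2 * a + real (k + n + n)) k"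
        unfolding idx by (rule pochhammer_product')
      moreover have "2 * a + real (k + n + n) = 2 * d - 1 + real k" by (simp add: d_def)
      moreover have "pochhammer (2 * a) (2 * (k + n)) = 4 ^ (k + n) * pochhammer a (k + n) * (A * B)"
        unfolding pochhammer_double AB by (subst power_mult) simp
      ultimately have P: "pochhammer (2 * d - 1 + real k) k =
          4 ^ (k + n) * pochhammer a (k + n) * (A * B) / pochhammer (2 * a) (k + n + n)"
        using pp(2)[of "k + n + n"] by (simp only: eq_divide_eq) (simp add: mult_ac)
      have "(-1) ^ n * (-1) ^ n = (1 :: real)" by (simp flip: power_mult_distrib)
      hence s: "(-r) ^ (k + n) * (-1) ^ n = (-1) ^ k * r ^ (k + n)"
        unfolding power_add power_minus[of r k] power_minus[of r n]
        by (metis (no_types, lifting) mult.assoc mult.commute mult.right_neutral)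
      have s': "(- r / 4) ^ k = (-1) ^ k * r ^ k / 4 ^ k"
        unfolding power_divide power_minus[of r k] ..
      have "T (k + n) n = ((-r) ^ (k + n) * (-1) ^ n) * (pochhammer a (k + n) / (A * B)) *
          (C n / (fact k * pochhammer (2 * a) (k + n + n)))"
        unfolding T_def AB by simp
      also have "\<dots> = (-1) ^ k * r ^ (k + n) * (pochhammer a (k + n) / (A * B)) *
          (C n / (fact k * pochhammer (2 * a) (k + n + n)))"
        unfolding s ..
      also have "\<dots> = C n * (r / 4) ^ n / A\<^sup>2 *
          (4 ^ (k + n) * pochhammer a (k + n) * (A * B) / pochhammer (2 * a) (k + n + n) /
           (fact k * B\<^sup>2) * (- r / 4) ^ k)"
        using ABpos pp(2)[of "k + n + n"] unfolding s'
        by (simp add: power_divide power_add power2_eq_square) (simp add: mult_ac)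
      finally show ?thesis unfolding P[symmetric] A_def[symmetric] B_def[symmetric] .
    qed
    have "(\<lambda>k. T (k + n) n) sums S n"
      unfolding eq S_def d_def[symmetric]
      by (intro sums_mult hyp0F1_square_sums d)
    moreover have "(\<Sum>m<n. T m n) = 0" by (simp add: T_def)
    ultimately show ?thesis using sums_iff_shift[of "\<lambda>m. T m n" n "S n"] by simp
  qed
  have colsum: "(\<lambda>m. T m n) summable_on UNIV" for n
  proof -
    have "(\<lambda>(n, m). T m n) summable_on UNIV \<times> UNIV"
      using summable_on_swap[THEN iffD1, OF sumT] by simp
    hence "(\<lambda>(n, m). T m n) summable_on Pair n ` UNIV"
      by (rule summable_on_subset_banach) auto
    thus ?thesis by (subst (asm) summable_on_reindex) (auto simp: o_def inj_on_def)
  qed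
  have col_inf: "infsum (\<lambda>m. T m n) UNIV = S n" for n
    using has_sum_imp_sums[OF has_sum_infsum[OF colsum[of n]]] cols[of n] by (rule sums_unique2)
  have row_inf: "infsum (\<lambda>n. T m n) UNIV = (\<Sum>n\<le>m. T m n)" for m
    by (rule infsumI, rule has_sum_finite_neutralI[of "{..m}"]) (auto simp: supp)
  have "infsum (\<lambda>m. infsum (\<lambda>n. T m n) UNIV) UNIV = infsum (\<lambda>n. infsum (\<lambda>m. T m n) UNIV) UNIV"
    by (rule infsum_swap_banach[OF sumT])
  hence inf_eq: "infsum (\<lambda>m. \<Sum>n\<le>m. T m n) UNIV = infsum S UNIV"
    by (simp only: row_inf col_inf)
  have sumT': "(\<lambda>(n, m). T m n) summable_on UNIV \<times> UNIV"
    using summable_on_swap[THEN iffD1, OF sumT] by simp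
  have "(\<lambda>n. infsum (\<lambda>m. T m n) UNIV) summable_on UNIV"
    using summable_on_Sigma_banach[of "\<lambda>n m. T m n" UNIV "\<lambda>_. UNIV"] sumT' by simp
  hence "S summable_on UNIV" by (simp only: col_inf)
  hence S1: "S sums infsum S UNIV" by (intro has_sum_imp_sums has_sum_infsum)
  have "(\<lambda>m. infsum (\<lambda>n. T m n) UNIV) summable_on UNIV"
    using summable_on_Sigma_banach[of T UNIV "\<lambda>_. UNIV"] sumT by simp
  hence "(\<lambda>m. \<Sum>n\<le>m. T m n) summable_on UNIV" by (simp only: row_inf)
  hence "(\<lambda>m. \<Sum>n\<le>m. T m n) sums infsum S UNIV"
    unfolding inf_eq[symmetric] by (intro has_sum_imp_sums has_sum_infsum)
  hence "infsum S UNIV = hyp1F2 a b c (-r)"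
    unfolding rows using hyp1F2_sums[OF a pos, of "-r"] by (rule sums_unique2)
  with S1 show ?thesis by (simp add: S_def C_def)
qed

text \<open>Put x = 2 a - b and y = b - a - 1/2. As x + y = a - 1/2 > -1/2 and x y >= 0, neither x
  nor y is below -1/2. So after the first factors x and y are split off, the remaining Pochhammer
  symbols start at x + 1 > 0 and y + 1 > 0, and all coefficients with positive index share the sign
  of x y.\<close>

lemma gasper_coeff_Suc_sign:
  fixes a b c :: real
  assumes "a > 0" "b > 0" "c > 0" and "(2 * a - b) * (b - a - 1/2) \<ge> 0"
  obtains R where "R > 0" "gasper_coeff a b c (Suc n) = R * ((2 * a - b) * (b - a - 1/2))"
proof -
  define x y where "x = 2 * a - b" and "y = b - a - 1/2"
  have xy: "x + 1 > 0" "y + 1 > 0"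
    using assms unfolding x_def y_def zero_le_mult_iff by auto
  define R where "R = (2 * real (Suc n) + 2 * a - 1) * pochhammer (2 * a) n / fact (Suc n) *
      (pochhammer (x + 1) n * pochhammer (y + 1) n) / (pochhammer b (Suc n) * pochhammer c (Suc n))"
  have "R > 0" unfolding R_def using assms xy
    by (intro divide_pos_pos mult_pos_pos pochhammer_pos) auto
  moreover have "gasper_coeff a b c (Suc n) = R * (x * y)"
    unfolding gasper_coeff_def x_def[symmetric] y_def[symmetric] R_def pochhammer_rec[of x n]
      pochhammer_rec[of y n] by simp
  ultimately show ?thesis using that unfolding x_def y_def by blast
qed

text \<open>For large d the constant term 1 dominates: the remaining terms sum to at most (exp |z| -
  1) / d < 1. Thus, at a given argument, Bessel functions of high order do not vanish.\<close>

lemma hyp0F1_nonzero_of_large: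
  fixes d z :: real
  assumes "d > exp \<bar>z\<bar>"
  shows "hyp0F1 d z \<noteq> 0"
proof
  assume z: "hyp0F1 d z = 0"
  have "exp \<bar>z\<bar> > 0" by simp
  hence d: "d > 0" using assms by linarith
  define f where "f = (\<lambda>k. z ^ k / (fact k * pochhammer d k))"
  have sf: "summable (\<lambda>k. norm (f k))" unfolding f_def by (rule summable_abs_hyp0F1[OF d])
  have sf': "summable f" by (rule summable_norm_cancel[OF sf])
  have "(\<Sum>k. f (Suc k)) = -1"
    using suminf_split_head[OF sf'] z by (simp add: hyp0F1_def f_def)
  hence "1 = norm (\<Sum>k. f (Suc k))" by simp
  also have "\<dots> \<le> (\<Sum>k. norm (f (Suc k)))"
    using sf by (intro summable_norm) (subst summable_Suc_iff)
  also have "\<dots> \<le> (\<Sum>k. \<bar>z\<bar> ^ Suc k / fact (Suc k) / d)"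
  proof (rule suminf_le)
    show "norm (f (Suc k)) \<le> \<bar>z\<bar> ^ Suc k / fact (Suc k) / d" for k
    proof -
      have "pochhammer d (Suc k) \<ge> d" using d by (rule pochhammer_Suc_ge)
      moreover have "norm (f (Suc k)) = \<bar>z\<bar> ^ Suc k / fact (Suc k) / pochhammer d (Suc k)"
        using pochhammer_pos[OF d, of "Suc k"]
        unfolding f_def by (simp add: abs_mult power_abs del: fact_Suc power_Suc)
      ultimately show ?thesis using d
        by (simp only:) (intro divide_left_mono mult_pos_pos, auto)
    qed
    show "summable (\<lambda>k. norm (f (Suc k)))" using sf by (subst summable_Suc_iff)
    have "summable (\<lambda>k. \<bar>z\<bar> ^ k / fact k)"
      using exp_converges[of "\<bar>z\<bar>"] by (simp add: sums_iff field_simps)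
    thus "summable (\<lambda>k. \<bar>z\<bar> ^ Suc k / fact (Suc k) / d)"
      by (intro summable_divide) (subst summable_Suc_iff)
  qed
  also have "\<dots> = (exp \<bar>z\<bar> - 1) / d"
  proof -
    have "(\<lambda>k. \<bar>z\<bar> ^ k / fact k) sums exp \<bar>z\<bar>"
      using exp_converges[of "\<bar>z\<bar>"] by (simp add: field_simps)
    hence "(\<lambda>k. \<bar>z\<bar> ^ Suc k / fact (Suc k)) sums (exp \<bar>z\<bar> - 1)"
      using sums_Suc_iff[of "\<lambda>k. \<bar>z\<bar> ^ k / fact k" "exp \<bar>z\<bar> - 1"] by simp
    from sums_divide[OF this, of d] show ?thesis by (simp only: sums_iff)
  qed
  also have "\<dots> < 1" using assms d by simp
  finally show False by simp
qed

text \<open>The condition \<open>sgn\<close> places b between 2 a and a + 1/2, which makes all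
  coefficients nonnegative. In the interior of the segment those with n > 0 are positive, and a
  square with large n is nonzero at the given r. At the endpoints only the square with n = 0
  remains, so positivity is claimed only away from them.\<close>

lemma hyp1F2_segment:
  fixes a b c r :: real
  assumes a: "a > 0" and b: "b > 0" and c: "c > 0" and bc: "b + c = 3 * a + 1/2"
    and sgn: "(2 * a - b) * (b - a - 1/2) \<ge> 0" and r: "r > 0"
  shows "hyp1F2 a b c (- r) \<ge> 0"
    and "(2 * a - b) * (b - a - 1/2) \<noteq> 0 \<Longrightarrow> hyp1F2 a b c (- r) > 0"
proof -
  have ba: "b \<ge> a" and ca: "c \<ge> a"
    using sgn a bc unfolding zero_le_mult_iff by auto
  define t where "t = (\<lambda>n. gasper_coeff a b c n * (r / 4) ^ n / (pochhammer (a + 1/2) n)\<^sup>2 *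
              (hyp0F1 (a + 1/2 + real n) (- r / 4))\<^sup>2)"
  have t: "t sums hyp1F2 a b c (- r)"
    unfolding t_def using r by (intro hyp1F2_sum_of_squares a ba ca bc) simp
  have C: "gasper_coeff a b c n \<ge> 0" for n
  proof (cases n)
    case 0
    thus ?thesis by (simp add: gasper_coeff_def)
  next
    case (Suc k)
    show ?thesis unfolding Suc
      by (rule gasper_coeff_Suc_sign[OF a b c sgn, of k]) (use sgn in simp)
  qed
  have t0: "t n \<ge> 0" for n
    unfolding t_def using C[of n] r by (intro mult_nonneg_nonneg divide_nonneg_nonneg) auto
  show "hyp1F2 a b c (- r) \<ge> 0" using sums_le[OF t0 sums_zero t] .
  assume nz: "(2 * a - b) * (b - a - 1/2) \<noteq> 0"
  obtain n0 :: nat where "exp \<bar>- r / 4\<bar> < real n0" using reals_Archimedean2 by blast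
  hence "hyp0F1 (a + 1/2 + real (Suc n0)) (- r / 4) \<noteq> 0"
    using a by (intro hyp0F1_nonzero_of_large) simp
  moreover have "gasper_coeff a b c (Suc n0) > 0"
    by (rule gasper_coeff_Suc_sign[OF a b c sgn, of n0]) (metis sgn nz mult_pos_pos order_le_less)
  moreover have "pochhammer (a + 1/2) (Suc n0) > 0" using a by (intro pochhammer_pos) simp
  ultimately have "t (Suc n0) > 0"
    unfolding t_def using r by (intro mult_pos_pos divide_pos_pos) auto
  thus "hyp1F2 a b c (- r) > 0"
    using suminf_pos2[of t] t t0 by (simp add: sums_iff)
qed

subsection \<open>Positivity on the Newton diagram\<close>

text \<open>Termwise integration against the Beta kernel multiplies the k-th coefficient by the
  normalized moment (p)_k / (p + \<delta>)_k, which is at most 1. The coefficients \<open>u\<close>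
  are arbitrary because the lemma serves both 1F2, to raise a lower parameter, and the exponential
  series, for Euler's integral.\<close>

lemma Beta_mixture:
  fixes p \<delta> z :: real and u :: "nat \<Rightarrow> real"
  assumes p: "p > 0" and \<delta>: "\<delta> > 0" and u: "summable (\<lambda>k. \<bar>u k * z ^ k\<bar>)"
  defines "w \<equiv> \<lambda>t. indicator {0..1} t * (t powr (p - 1) * (1 - t) powr (\<delta> - 1))"
  shows "integrable lborel (\<lambda>t. w t * (\<Sum>k. u k * (z * t) ^ k))"
    and "(\<lambda>k. u k * (pochhammer p k / pochhammer (p + \<delta>) k) * z ^ k) sums
           ((\<integral>t. w t * (\<Sum>k. u k * (z * t) ^ k) \<partial>lborel) / Beta p \<delta>)"
proof -
  have B: "Beta p \<delta> > 0" using p \<delta> by (simp add: Beta_def)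
  have mom: "has_bochner_integral lborel (\<lambda>t. w t * t ^ k)
      (Beta p \<delta> * (pochhammer p k / pochhammer (p + \<delta>) k))" for k
  proof -
    have int: "set_integrable lborel {0..1} (\<lambda>t. t powr (p + real k - 1) * (1 - t) powr (\<delta> - 1))"
      using p \<delta> by (intro integrable_Beta) auto
    \<comment> \<open>At t = 0 both sides are 0, because \<open>0 powr x\<close> is 0 for every x;
      hence the case k = 0 is no exception.\<close>
    have eq: "indicator {0..1} t *\<^sub>R (t powr (p + real k - 1) * (1 - t) powr (\<delta> - 1)) = w t * t ^ k" for t
    proof (cases "t \<in> {0<..1}")
      case True
      thus ?thesis by (simp add: w_def powr_realpow[symmetric] powr_add[symmetric] algebra_simps
            flip: powr_add)
    next
      case False
      hence "t = 0 \<or> t \<notin> {0..1}" by auto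
      thus ?thesis by (auto simp: w_def)
    qed
    have "integrable lborel (\<lambda>t. w t * t ^ k)"
      using int unfolding set_integrable_def eq .
    moreover have "(\<integral>t. w t * t ^ k \<partial>lborel) = Beta (p + real k) \<delta>"
    proof -
      have "((\<lambda>t. t powr (p + real k - 1) * (1 - t) powr (\<delta> - 1)) has_integral
          Beta (p + real k) \<delta>) {0..1}"
        using p \<delta> by (intro has_integral_Beta_real) auto
      hence "(LINT t:{0..1}|lborel. t powr (p + real k - 1) * (1 - t) powr (\<delta> - 1)) =
          Beta (p + real k) \<delta>"
        using set_borel_integral_eq_integral(2)[OF int] by (simp add: integral_unique)
      thus ?thesis unfolding set_lebesgue_integral_def eq .
    qed
    moreover have "Beta (p + real k) \<delta> = Beta p \<delta> * (pochhammer p k / pochhammer (p + \<delta>) k)"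
    proof -
      have "pochhammer p k = Gamma (p + real k) / Gamma p"
           "pochhammer (p + \<delta>) k = Gamma (p + \<delta> + real k) / Gamma (p + \<delta>)"
        using p \<delta> by (auto intro!: pochhammer_Gamma simp: nonpos_Ints_def)
      moreover have "Gamma p > 0" "Gamma (p + \<delta>) > 0" using p \<delta> by (auto intro: Gamma_real_pos)
      ultimately show ?thesis by (simp add: Beta_def add_ac)
    qed
    ultimately show ?thesis by (simp add: has_bochner_integral_iff)
  qed
  have w0: "w t \<ge> 0" for t by (auto simp: w_def)
  define f where "f = (\<lambda>k t. w t * (u k * (z * t) ^ k))"
  have f_eq: "f k t = u k * z ^ k * (w t * t ^ k)" for k t
    by (simp add: f_def power_mult_distrib)
  have f_int: "integrable lborel (f k)" for k
    unfolding f_eq using mom[of k] by (simp add: has_bochner_integral_iff)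
  have ratio: "\<bar>pochhammer p k / pochhammer (p + \<delta>) k\<bar> \<le> 1" for k
    using abs_pochhammer_le[of p "p + \<delta>" k] p \<delta> pochhammer_pos[of "p + \<delta>" k]
    by (simp add: abs_mult)
  have w_supp: "w t = 0" if "t \<notin> {0..1}" for t using that by (simp add: w_def)
  have sum_pt: "summable (\<lambda>k. norm (f k t))" for t
  proof (cases "t \<in> {0..1}")
    case True
    have "summable (\<lambda>k. w t * \<bar>u k * z ^ k\<bar>)" using u by (rule summable_mult)
    thus ?thesis
    proof (rule summable_comparison_test'[where N = 0])
      fix k
      have "norm (norm (f k t)) = w t * \<bar>u k * z ^ k\<bar> * t ^ k"
        unfolding f_eq using w0[of t] True by (simp add: abs_mult)
      also have "\<dots> \<le> w t * \<bar>u k * z ^ k\<bar> * 1"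
        using w0[of t] True by (intro mult_left_mono) (auto intro: power_le_one)
      finally show "norm (norm (f k t)) \<le> w t * \<bar>u k * z ^ k\<bar>" by simp
    qed
  qed (simp add: f_def w_supp)
  have norm_int: "(\<integral>t. norm (f k t) \<partial>lborel) =
      \<bar>u k * z ^ k\<bar> * (Beta p \<delta> * (pochhammer p k / pochhammer (p + \<delta>) k))" for k
  proof -
    have "norm (f k t) = \<bar>u k * z ^ k\<bar> * (w t * t ^ k)" for t
      unfolding f_eq using w0[of t] by (cases "t \<in> {0..1}") (auto simp: abs_mult w_supp)
    thus ?thesis using mom[of k] by (simp add: has_bochner_integral_iff)
  qed
  have sum_int: "summable (\<lambda>k. \<integral>t. norm (f k t) \<partial>lborel)"
  proof (rule summable_comparison_test'[where N = 0])
    show "summable (\<lambda>k. \<bar>u k * z ^ k\<bar> * Beta p \<delta>)" using u by (rule summable_mult2)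
    fix k
    have "norm (\<integral>t. norm (f k t) \<partial>lborel) =
        (\<bar>u k * z ^ k\<bar> * Beta p \<delta>) * \<bar>pochhammer p k / pochhammer (p + \<delta>) k\<bar>"
      unfolding norm_int using B by (simp add: abs_mult)
    also have "\<dots> \<le> (\<bar>u k * z ^ k\<bar> * Beta p \<delta>) * 1"
      using ratio B by (intro mult_left_mono) auto
    finally show "norm (\<integral>t. norm (f k t) \<partial>lborel) \<le> \<bar>u k * z ^ k\<bar> * Beta p \<delta>" by simp
  qed
  have suminf_eq: "(\<Sum>k. f k t) = w t * (\<Sum>k. u k * (z * t) ^ k)" for t
  proof (cases "w t = 0")
    case False
    have "summable (\<lambda>k. f k t)" using summable_norm_cancel[OF sum_pt[of t]] .
    hence "summable (\<lambda>k. u k * (z * t) ^ k)"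
      using False summable_mult[of "\<lambda>k. f k t" "1 / w t"] by (simp add: f_def)
    thus ?thesis unfolding f_def by (rule suminf_mult)
  qed (simp add: f_def)
  show "integrable lborel (\<lambda>t. w t * (\<Sum>k. u k * (z * t) ^ k))"
    using integrable_suminf[OF f_int _ sum_int] sum_pt unfolding suminf_eq by simp
  have "(\<lambda>k. \<integral>t. f k t \<partial>lborel) sums (\<integral>t. w t * (\<Sum>k. u k * (z * t) ^ k) \<partial>lborel)"
    using sums_integral[OF f_int _ sum_int] sum_pt unfolding suminf_eq by simp
  hence "(\<lambda>k. (\<integral>t. f k t \<partial>lborel) / Beta p \<delta>) sums
      ((\<integral>t. w t * (\<Sum>k. u k * (z * t) ^ k) \<partial>lborel) / Beta p \<delta>)"
    by (rule sums_divide)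
  moreover have "(\<integral>t. f k t \<partial>lborel) / Beta p \<delta> =
      u k * (pochhammer p k / pochhammer (p + \<delta>) k) * z ^ k" for k
    unfolding f_eq using mom[of k] B by (simp add: has_bochner_integral_iff)
  ultimately show "(\<lambda>k. u k * (pochhammer p k / pochhammer (p + \<delta>) k) * z ^ k) sums
           ((\<integral>t. w t * (\<Sum>k. u k * (z * t) ^ k) \<partial>lborel) / Beta p \<delta>)"
    by simp
qed

text \<open>With p = b the Beta moments trade (b)_k for (b + \<delta>)_k in the denominator. The
  resulting integrand is nonnegative, and it is positive near t = 0 because 1F2 has the value 1 at
  0, so the integral cannot vanish.\<close>

lemma hyp1F2_raise:
  fixes a b c \<delta> r :: real
  assumes a: "a > 0" and b: "b > 0" and c: "c > 0" and \<delta>: "\<delta> > 0"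
    and nonneg: "\<And>r. r > 0 \<Longrightarrow> hyp1F2 a b c (- r) \<ge> 0" and r: "r > 0"
  shows "hyp1F2 a (b + \<delta>) c (- r) > 0"
proof -
  define u where "u = (\<lambda>k. pochhammer a k / (fact k * pochhammer b k * pochhammer c k))"
  define w where "w = (\<lambda>t. indicator {0..1} t * (t powr (b - 1) * (1 - t) powr (\<delta> - 1)))"
  define f where "f = (\<lambda>t. w t * hyp1F2 a b c (- r * t))"
  have f_eq: "f = (\<lambda>t. w t * (\<Sum>k. u k * (- r * t) ^ k))"
    by (simp add: f_def u_def hyp1F2_def)
  have u: "summable (\<lambda>k. \<bar>u k * (- r) ^ k\<bar>)"
    unfolding u_def by (rule summable_abs_hyp1F2[OF a b c])
  have f_int: "integrable lborel f"
    unfolding f_eq w_def by (rule Beta_mixture(1)[OF b \<delta> u])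
  have "(\<lambda>k. u k * (pochhammer b k / pochhammer (b + \<delta>) k) * (- r) ^ k) sums
      ((\<integral>t. f t \<partial>lborel) / Beta b \<delta>)"
    unfolding f_eq w_def by (rule Beta_mixture(2)[OF b \<delta> u])
  moreover have "u k * (pochhammer b k / pochhammer (b + \<delta>) k) =
      pochhammer a k / (fact k * pochhammer (b + \<delta>) k * pochhammer c k)" for k
    using pochhammer_pos[OF b, of k] by (simp add: u_def)
  ultimately have "(\<lambda>k. pochhammer a k / (fact k * pochhammer (b + \<delta>) k * pochhammer c k) * (- r) ^ k)
      sums ((\<integral>t. f t \<partial>lborel) / Beta b \<delta>)"
    by (simp only:)
  moreover have "b + \<delta> > 0" using b \<delta> by simp
  ultimately have eq: "hyp1F2 a (b + \<delta>) c (- r) = (\<integral>t. f t \<partial>lborel) / Beta b \<delta>"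
    using hyp1F2_sums[OF a _ c] sums_unique2 by blast
  have f0: "f t \<ge> 0" for t
  proof (cases "t \<in> {0<..1}")
    case True
    thus ?thesis using nonneg[of "r * t"] r by (simp add: f_def w_def)
  next
    case False
    hence "t = 0 \<or> t \<notin> {0..1}" by auto
    thus ?thesis by (auto simp: f_def w_def)
  qed
  have "(\<integral>t. f t \<partial>lborel) \<noteq> 0"
  proof
    assume "(\<integral>t. f t \<partial>lborel) = 0"
    hence ae: "AE t in lborel. f t = 0"
      using integral_nonneg_eq_0_iff_AE[OF f_int] f0 by auto
    have "isCont (hyp1F2 a b c) 0"
      using continuous_hyp1F2[OF a b c, of UNIV] by (simp add: continuous_on_eq_continuous_at)
    hence "\<forall>\<^sub>F z in at 0. hyp1F2 a b c z > 0"
      unfolding isCont_def by (intro order_tendstoD(1)) auto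
    then obtain \<eta> where \<eta>: "\<eta> > 0" "\<And>z. z \<noteq> 0 \<Longrightarrow> \<bar>z\<bar> < \<eta> \<Longrightarrow> hyp1F2 a b c z > 0"
      unfolding eventually_at by (auto simp: dist_real_def)
    define \<epsilon> where "\<epsilon> = min 1 (\<eta> / r)"
    have \<epsilon>: "\<epsilon> > 0" using \<eta> r by (simp add: \<epsilon>_def)
    have fpos: "f t > 0" if "t \<in> {0<..<\<epsilon>}" for t
    proof -
      have "r * t < \<eta>" "0 < t" "t < 1" using that r by (auto simp: \<epsilon>_def field_simps)
      thus ?thesis using \<eta>(2)[of "- r * t"] r
        by (simp add: f_def w_def abs_mult)
    qed
    have "AE t in lborel. t \<notin> {0<..<\<epsilon>}"
      using ae by eventually_elim (use fpos in force)
    hence "emeasure lborel {t \<in> space lborel. \<not> t \<notin> {0<..<\<epsilon>}} = 0"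
      by (subst (asm) AE_iff_measurable[OF _ refl]) auto
    moreover have "{t \<in> space lborel. \<not> t \<notin> {0<..<\<epsilon>}} = {0<..<\<epsilon>}" by auto
    ultimately show False using \<epsilon> by simp
  qed
  moreover have "(\<integral>t. f t \<partial>lborel) \<ge> 0" using f0 by simp
  moreover have "Beta b \<delta> > 0" using b \<delta> by (simp add: Beta_def)
  ultimately show ?thesis unfolding eq by simp
qed

text \<open>Going right along the segment lowers the ordinate, so the witness is the rightmost
  abscissa on the segment that does not exceed b. It yields a point of the segment from which (b, c)
  is reached by raising parameters.\<close>

lemma segment_below:
  fixes a b c :: real
  defines "m \<equiv> min (a + 1/2) (2 * a)"
  assumes "m \<le> b" "m \<le> c" "3 * a + 1/2 \<le> b + c"
  obtains b' where "b' \<in> closed_segment (a + 1/2) (2 * a)" "b' \<le> b" "3 * a + 1/2 - b' \<le> c"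
proof
  show "min b (max (a + 1/2) (2 * a)) \<in> closed_segment (a + 1/2) (2 * a)"
    using assms by (auto simp: closed_segment_eq_real_ivl m_def)
qed (use assms in \<open>auto simp: m_def\<close>)

text \<open>The half-planes are convex and contain both quadrants, which gives one inclusion. For
  the other, a point is a nonnegative translate of a point of the segment; translating both
  endpoints by the same vector exhibits it as a convex combination of points of the two
  quadrants.\<close>

lemma newton_diagram_Lam:
  fixes a :: real
  defines "m \<equiv> min (a + 1/2) (2 * a)"
  shows "newton_diagram (Lam a) = {(b, c). m \<le> b \<and> m \<le> c \<and> 3 * a + 1/2 \<le> b + c}"
    (is "_ = ?R")
proof
  have gen: "(\<Union>(\<alpha>, \<beta>)\<in>Lam a. {(x, y). x \<ge> \<alpha> \<and> y \<ge> \<beta>}) =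
      {(x, y). x \<ge> a + 1/2 \<and> y \<ge> 2 * a} \<union> {(x, y). x \<ge> 2 * a \<and> y \<ge> a + 1/2}"
    by (auto simp: Lam_def)
  have R: "?R = {z. (1, 0) \<bullet> z \<ge> m} \<inter> {z. (0, 1) \<bullet> z \<ge> m} \<inter> {z. (1, 1) \<bullet> z \<ge> 3 * a + 1/2}"
    by (auto simp: inner_prod_def)
  have "convex ?R" unfolding R by (intro convex_Int convex_halfspace_ge)
  thus "newton_diagram (Lam a) \<subseteq> ?R"
    unfolding newton_diagram_def gen by (intro hull_minimal) (auto simp: m_def)
  show "?R \<subseteq> newton_diagram (Lam a)"
  proof safe
    fix b c assume *: "m \<le> b" "m \<le> c" "3 * a + 1/2 \<le> b + c"
    obtain b' where b': "b' \<in> closed_segment (a + 1/2) (2 * a)" "b' \<le> b" "3 * a + 1/2 - b' \<le> c"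
      using * segment_below[of a b c] unfolding m_def by blast
    then obtain u where u: "0 \<le> u" "u \<le> 1" "b' = (1 - u) * (a + 1/2) + u * (2 * a)"
      by (auto simp: closed_segment_def)
    define d e where "d = b - b'" and "e = c - (3 * a + 1/2 - b')"
    define p q where "p = (a + 1/2 + d, 2 * a + e)" and "q = (2 * a + d, a + 1/2 + e)"
    have "(b, c) = (1 - u) *\<^sub>R p + u *\<^sub>R q"
      by (simp add: p_def q_def d_def e_def u(3) field_simps)
    moreover have "p \<in> newton_diagram (Lam a)" "q \<in> newton_diagram (Lam a)"
      unfolding newton_diagram_def gen p_def q_def using b'
      by (auto intro!: hull_inc simp: d_def e_def)
    moreover have "convex (newton_diagram (Lam a))" by (simp add: newton_diagram_def)
    ultimately show "(b, c) \<in> newton_diagram (Lam a)"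
      using convexD_alt[of "newton_diagram (Lam a)" p q u] u by simp
  qed
qed

text \<open>Start from the segment point below (b, c) and raise first b', then c'. A single strict
  increase already gives positivity, so only points of the segment itself need the finer statement
  of \<open>hyp1F2_segment\<close>, whose exceptions are exactly the two points of
  \<open>Lam a\<close>.\<close>

lemma hyp1F2_newton_diagram:
  fixes a b c r :: real
  assumes a: "a > 0" and P: "(b, c) \<in> newton_diagram (Lam a)" and r: "r > 0"
  shows "hyp1F2 a b c (- r) \<ge> 0" and "(b, c) \<notin> Lam a \<Longrightarrow> hyp1F2 a b c (- r) > 0"
proof -
  have bc: "min (a + 1/2) (2 * a) \<le> b" "min (a + 1/2) (2 * a) \<le> c" "3 * a + 1/2 \<le> b + c"
    using P unfolding newton_diagram_Lam by auto
  obtain b' where b': "b' \<in> closed_segment (a + 1/2) (2 * a)" "b' \<le> b" "3 * a + 1/2 - b' \<le> c"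
    using segment_below[OF bc] .
  define c' where "c' = 3 * a + 1/2 - b'"
  have pos: "b' > 0" "c' > 0" and sum: "b' + c' = 3 * a + 1/2" and c': "c' \<le> c"
    using b' a by (auto simp: c'_def closed_segment_eq_real_ivl split: if_splits)
  have sgn: "(2 * a - b') * (b' - a - 1/2) \<ge> 0"
    using b'(1) by (auto simp: closed_segment_eq_real_ivl zero_le_mult_iff split: if_splits)
  note seg = hyp1F2_segment[OF a pos sum sgn]
  consider "b' = b" "c' = c" | "b' < b" "c' = c" | "c' < c" using b'(2) c' by linarith
  hence "hyp1F2 a b c (- r) \<ge> 0 \<and> ((b, c) \<notin> Lam a \<longrightarrow> hyp1F2 a b c (- r) > 0)"
  proof cases
    case 1
    have "(2 * a - b') * (b' - a - 1/2) \<noteq> 0" if "(b, c) \<notin> Lam a"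
      using that 1 sum by (auto simp: Lam_def)
    thus ?thesis using seg[OF r] 1 by simp
  next
    case 2
    thus ?thesis using hyp1F2_raise[OF a pos, of "b - b'" r] seg(1) r by simp
  next
    case 3
    have "hyp1F2 a b c' (- s) \<ge> 0" if "s > 0" for s
    proof (cases "b' = b")
      case False
      thus ?thesis
        using hyp1F2_raise[OF a pos, of "b - b'" s] seg(1) b'(2) that by simp
    qed (use seg(1) that in simp)
    hence "hyp1F2 a c' b (- s) \<ge> 0" if "s > 0" for s
      using that by (subst hyp1F2_commute)
    hence "hyp1F2 a c b (- r) > 0"
      using hyp1F2_raise[OF a pos(2), of b "c - c'" r] 3 r pos b'(2) by simp
    thus ?thesis by (subst (1 2) hyp1F2_commute) simp
  qed
  thus "hyp1F2 a b c (- r) \<ge> 0" and "(b, c) \<notin> Lam a \<Longrightarrow> hyp1F2 a b c (- r) > 0" by auto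
qed

subsection \<open>Laplace transforms\<close>

text \<open>The substitution t = s r^m reduces this to Euler's integral for Gamma. The exponent m =
  1 belongs to the ordinary Laplace kernel, m = 1/2 to the kernel exp (-2 s sqrt r).\<close>

lemma Gamma_powr_integral:
  fixes p s m :: real
  assumes p: "p > 0" and s: "s > 0" and m: "m > 0"
  shows "has_bochner_integral lborel
           (\<lambda>r. indicator {0<..} r * (r powr (p - 1) * exp (- s * r powr m)))
           (Gamma (p / m) / (m * s powr (p / m)))"
proof -
  define P where "P = p / m"
  have P: "P > 0" using p m by (simp add: P_def)
  define f where "f = (\<lambda>t::real. t powr (P - 1) / exp t)"
  define g where "g = (\<lambda>r::real. s * r powr m)"
  have hi: "(f has_integral Gamma P) {0<..}"
  proof -
    have "(f has_integral Gamma P) {0..}" unfolding f_def by (rule Gamma_integral_real[OF P])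
    thus ?thesis
      by (rule has_integral_spike_set_eq[THEN iffD1, rotated 2])
         (rule negligible_subset[of "{0}"], auto)+
  qed
  have fabs: "f absolutely_integrable_on {0<..}"
    using hi by (intro nonnegative_absolutely_integrable_1) (auto simp: f_def has_integral_integrable)
  have img: "g ` {0<..} = {0<..}"
  proof safe
    fix t :: real assume t: "t > 0"
    show "t \<in> g ` {0<..}"
    proof (rule image_eqI[of _ _ "(t / s) powr (1 / m)"])
      show "t = g ((t / s) powr (1 / m))" using t s m by (simp add: g_def powr_powr)
      show "(t / s) powr (1 / m) \<in> {0<..}" using t s by simp
    qed
  qed (use s in \<open>auto simp: g_def\<close>)
  have inj: "inj_on g {0<..}"
  proof (rule inj_onI)
    fix x y assume xy: "x \<in> {0<..}" "y \<in> {0<..}" "g x = g y"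
    hence "(x powr m) powr (1 / m) = (y powr m) powr (1 / m)" using s by (simp add: g_def)
    thus "x = y" using xy m by (simp add: powr_powr)
  qed
  have der: "(g has_field_derivative s * (m * r powr (m - 1))) (at r within {0<..})"
    if "r \<in> {0<..}" for r
    unfolding g_def using that by (auto intro!: derivative_eq_intros)
  have main: "(\<lambda>r. \<bar>s * (m * r powr (m - 1))\<bar> * f (g r)) absolutely_integrable_on {0<..} \<and>
      integral {0<..} (\<lambda>r. \<bar>s * (m * r powr (m - 1))\<bar> * f (g r)) = Gamma P"
    using has_absolute_integral_change_of_variables_1'[OF _ der inj, of f "Gamma P"] fabs hi
    unfolding img by (simp add: integral_unique)
  define h where "h = (\<lambda>r. indicator {0<..} r * (r powr (p - 1) * exp (- s * r powr m)))"
  have h_eq: "indicator {0<..} r *\<^sub>R (\<bar>s * (m * r powr (m - 1))\<bar> * f (g r)) = (m * s powr P) * h r" for r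
  proof (cases "r > 0")
    case True
    have "(s * r powr m) powr (P - 1) = s powr (P - 1) * r powr (m * (P - 1))"
      using s True by (simp add: powr_mult powr_powr)
    also have "m * (P - 1) = p - m" using m by (simp add: P_def field_simps)
    finally have "(s * r powr m) powr (P - 1) = s powr (P - 1) * r powr (p - m)" .
    hence "\<bar>s * (m * r powr (m - 1))\<bar> * f (g r) =
        m * (s * s powr (P - 1)) * (r powr (m - 1) * r powr (p - m)) * exp (- (s * r powr m))"
      using s m True by (simp add: f_def g_def exp_minus field_simps)
    also have "s * s powr (P - 1) = s powr P" using s by (simp add: powr_mult_base)
    also have "r powr (m - 1) * r powr (p - m) = r powr (p - 1)" by (simp flip: powr_add)
    finally show ?thesis using True by (simp add: h_def)
  qed (auto simp: h_def)
  have hm: "h \<in> borel_measurable lborel" unfolding h_def by measurable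
  have c0: "m * s powr P > 0" using s m by simp
  have "integrable lebesgue (\<lambda>r. (m * s powr P) * h r)"
    using main unfolding set_integrable_def h_eq by blast
  hence int: "integrable lborel (\<lambda>r. (m * s powr P) * h r)"
    using hm by (subst (asm) integrable_completion) auto
  have "integral\<^sup>L lebesgue (\<lambda>r. (m * s powr P) * h r) = Gamma P"
    using set_lebesgue_integral_eq_integral(2)[OF conjunct1[OF main]] conjunct2[OF main]
    unfolding set_lebesgue_integral_def h_eq by simp
  hence "integral\<^sup>L lborel (\<lambda>r. (m * s powr P) * h r) = Gamma P"
    using hm by (subst (asm) integral_completion) auto
  hence "(m * s powr P) * integral\<^sup>L lborel h = Gamma P" by simp
  hence "integral\<^sup>L lborel h = Gamma P / (m * s powr P)" using c0 by (metis nonzero_mult_div_cancel_left less_irrefl)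
  moreover have "integrable lborel h"
    using int s m by auto
  ultimately show ?thesis unfolding h_def P_def has_bochner_integral_iff by simp
qed

text \<open>The counterpart of \<open>Beta_mixture\<close> on the half-line. Gamma moments grow with
  k, so the interchange needs the assumption \<open>U\<close>: up to the factor m, it says that the
  integrals of the absolute values of the terms have a finite sum.\<close>

lemma Gamma_mixture:
  fixes p s m :: real and u :: "nat \<Rightarrow> real"
  assumes p: "p > 0" and s: "s > 0" and m: "m > 0"
    and u: "\<And>r. r > 0 \<Longrightarrow> summable (\<lambda>k. \<bar>u k\<bar> * r ^ k)"
    and U: "summable (\<lambda>k. \<bar>u k\<bar> * (Gamma ((p + real k) / m) / s powr ((p + real k) / m)))"
  defines "w \<equiv> \<lambda>r. indicator {0<..} r * (r powr (p - 1) * exp (- s * r powr m))"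
  shows "integrable lborel (\<lambda>r. w r * (\<Sum>k. u k * r ^ k))"
    and "(\<lambda>k. u k * (Gamma ((p + real k) / m) / (m * s powr ((p + real k) / m)))) sums
           (\<integral>r. w r * (\<Sum>k. u k * r ^ k) \<partial>lborel)"
proof -
  define G where "G = (\<lambda>k. Gamma ((p + real k) / m) / (m * s powr ((p + real k) / m)))"
  have mom: "has_bochner_integral lborel (\<lambda>r. w r * r ^ k) (G k)" for k
  proof -
    have "w r * r ^ k = indicator {0<..} r * (r powr (p + real k - 1) * exp (- s * r powr m))" for r
    proof (cases "r > 0")
      case True
      have "r powr (p - 1) * r ^ k = r powr (p + real k - 1)"
      proof -
        have "p + real k - 1 = (p - 1) + real k" by simp
        thus ?thesis using True by (simp only: powr_add powr_realpow)
      qed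
      thus ?thesis using True by (simp add: w_def mult_ac)
    qed (auto simp: w_def)
    thus ?thesis unfolding G_def using Gamma_powr_integral[of "p + real k" s m] p s m by simp
  qed
  have w0: "w r \<ge> 0" for r by (simp add: w_def)
  have w_supp: "w r = 0" if "\<not> r > 0" for r using that by (simp add: w_def)
  define f where "f = (\<lambda>k r. w r * (u k * r ^ k))"
  have f_eq: "f k r = u k * (w r * r ^ k)" for k r by (simp add: f_def)
  have f_int: "integrable lborel (f k)" for k
    unfolding f_eq using mom[of k] by (simp add: has_bochner_integral_iff)
  have sum_pt: "summable (\<lambda>k. norm (f k r))" for r
  proof (cases "r > 0")
    case True
    have "norm (f k r) = w r * (\<bar>u k\<bar> * r ^ k)" for k
      using True w0[of r] by (simp add: f_def abs_mult)
    thus ?thesis using summable_mult[OF u[OF True], of "w r"] by simp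
  qed (simp add: f_def w_supp)
  have norm_int: "(\<integral>r. norm (f k r) \<partial>lborel) = \<bar>u k\<bar> * G k" for k
  proof -
    have "norm (f k r) = \<bar>u k\<bar> * (w r * r ^ k)" for r
      unfolding f_eq using w0[of r] by (cases "r > 0") (auto simp: abs_mult w_supp)
    thus ?thesis using mom[of k] by (simp add: has_bochner_integral_iff)
  qed
  have sum_int: "summable (\<lambda>k. \<integral>r. norm (f k r) \<partial>lborel)"
    unfolding norm_int G_def using summable_divide[OF U, of m] by (simp add: mult.commute)
  have suminf_eq: "(\<Sum>k. f k r) = w r * (\<Sum>k. u k * r ^ k)" for r
  proof (cases "r > 0")
    case True
    have "summable (\<lambda>k. norm (u k * r ^ k))" using u[OF True] True by (simp add: abs_mult)
    thus ?thesis unfolding f_def by (rule suminf_mult[OF summable_norm_cancel])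
  qed (simp add: f_def w_supp)
  show "integrable lborel (\<lambda>r. w r * (\<Sum>k. u k * r ^ k))"
    using integrable_suminf[OF f_int _ sum_int] sum_pt unfolding suminf_eq by simp
  have "(\<lambda>k. \<integral>r. f k r \<partial>lborel) sums (\<integral>r. w r * (\<Sum>k. u k * r ^ k) \<partial>lborel)"
    using sums_integral[OF f_int _ sum_int] sum_pt unfolding suminf_eq by simp
  moreover have "(\<integral>r. f k r \<partial>lborel) = u k * G k" for k
    unfolding f_eq using mom[of k] by (simp add: has_bochner_integral_iff)
  ultimately show "(\<lambda>k. u k * (Gamma ((p + real k) / m) / (m * s powr ((p + real k) / m)))) sums
           (\<integral>r. w r * (\<Sum>k. u k * r ^ k) \<partial>lborel)"
    by (simp add: G_def)
qed

definition hyp1F1 :: "real \<Rightarrow> real \<Rightarrow> real \<Rightarrow> real" where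
  "hyp1F1 a c z = (\<Sum>k. pochhammer a k / (fact k * pochhammer c k) * z ^ k)"

lemma Gamma_add_nat:
  fixes p :: real
  assumes "p > 0"
  shows "Gamma (p + real k) = Gamma p * pochhammer p k"
proof -
  have "p \<notin> \<int>\<^sub>\<le>\<^sub>0" using assms by (auto simp: nonpos_Ints_def)
  thus ?thesis using pochhammer_Gamma[of p k] Gamma_real_pos[OF assms] by simp
qed

text \<open>The k-th moment produces Gamma (b + k) = Gamma b * (b)_k, which cancels the lower
  parameter b and leaves a 1F1 at -1/s.\<close>

lemma Laplace_hyp1F2:
  fixes a b c s :: real
  assumes a: "a > 0" and b: "b > 0" and c: "c > 0" and s: "s > 0"
  shows "has_bochner_integral lborel
           (\<lambda>r. indicator {0<..} r * (r powr (b - 1) * exp (- s * r)) * hyp1F2 a b c (- r))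
           (Gamma b / s powr b * hyp1F1 a c (- 1 / s))"
proof -
  define u where "u = (\<lambda>k. pochhammer a k / (fact k * pochhammer b k * pochhammer c k) * (-1) ^ k)"
  have pp: "pochhammer a k > 0" "pochhammer b k > 0" "pochhammer c k > 0" for k
    using a b c by (auto intro: pochhammer_pos)
  have abs_u: "\<bar>u k\<bar> = pochhammer a k / (fact k * pochhammer b k * pochhammer c k)" for k
    using pp[of k] by (simp add: u_def abs_mult)
  have g: "Gamma ((b + real k) / 1) / s powr ((b + real k) / 1) =
      Gamma b / s powr b * (pochhammer b k * (1 / s) ^ k)" for k
    using s b by (simp add: Gamma_add_nat powr_add powr_realpow power_one_over)
  have 1: "summable (\<lambda>k. \<bar>u k\<bar> * r ^ k)" if "r > 0" for r
    unfolding abs_u using summable_hyp1F2[OF a b c, of r] that by simp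
  have "summable (\<lambda>k. Gamma b / s powr b * (pochhammer a k / (fact k * pochhammer c k) * (1 / s) ^ k))"
    using s by (intro summable_mult summable_hyp1F1 a c) simp
  also have "(\<lambda>k. Gamma b / s powr b * (pochhammer a k / (fact k * pochhammer c k) * (1 / s) ^ k)) =
      (\<lambda>k. \<bar>u k\<bar> * (Gamma ((b + real k) / 1) / s powr ((b + real k) / 1)))"
    unfolding g abs_u using pp(2) by (intro ext) (simp add: less_imp_neq[symmetric] mult_ac)
  finally have 2: "summable (\<lambda>k. \<bar>u k\<bar> * (Gamma ((b + real k) / 1) / s powr ((b + real k) / 1)))" .
  have F: "(\<Sum>k. u k * r ^ k) = hyp1F2 a b c (- r)" for r
    unfolding hyp1F2_def u_def by (simp add: power_minus[of r] mult_ac)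
  have w: "indicator {0<..} r * (r powr (b - 1) * exp (- s * r powr 1)) * h =
      indicator {0<..} r * (r powr (b - 1) * exp (- s * r)) * h" for r h :: real
    by (auto simp: indicator_def)
  note mix = Gamma_mixture[of b s 1 u, OF b s zero_less_one 1 2, unfolded w F]
  have "u k * (Gamma ((b + real k) / 1) / (1 * s powr ((b + real k) / 1))) =
      Gamma b / s powr b * (pochhammer a k / (fact k * pochhammer c k) * (- 1 / s) ^ k)" for k
  proof -
    have "(- 1 / s) ^ k = (-1) ^ k * (1 / s) ^ k" by (simp flip: power_mult_distrib)
    thus ?thesis unfolding mult_1 g u_def using pp(2)[of k] by (simp add: mult_ac)
  qed
  hence "(\<lambda>k. Gamma b / s powr b * (pochhammer a k / (fact k * pochhammer c k) * (- 1 / s) ^ k)) sums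
      (\<integral>r. indicator {0<..} r * (r powr (b - 1) * exp (- s * r)) * hyp1F2 a b c (- r) \<partial>lborel)"
    using mix(2) by simp
  moreover have "(\<lambda>k. Gamma b / s powr b * (pochhammer a k / (fact k * pochhammer c k) * (- 1 / s) ^ k)) sums
      (Gamma b / s powr b * hyp1F1 a c (- 1 / s))"
  proof (intro sums_mult)
    have "summable (\<lambda>k. norm (pochhammer a k / (fact k * pochhammer c k) * (- 1 / s) ^ k))"
      using summable_hyp1F1[OF a c, of "1 / s"] s pp(1,3)
      by (simp add: abs_mult power_abs abs_of_pos)
    thus "(\<lambda>k. pochhammer a k / (fact k * pochhammer c k) * (- 1 / s) ^ k) sums hyp1F1 a c (- 1 / s)"
      unfolding hyp1F1_def by (rule summable_sums[OF summable_norm_cancel])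
  qed
  ultimately show ?thesis
    using mix(1) sums_unique2 unfolding has_bochner_integral_iff by blast
qed

text \<open>The constant is \<theta>^\<theta> exp (-\<theta>), the maximum of x^\<theta> exp (-x),
  attained at x = \<theta>.\<close>

lemma exp_minus_le_powr:
  fixes x \<theta> :: real
  assumes "\<theta> > 0" "x > 0"
  shows "exp (- x) \<le> exp (\<theta> * ln \<theta> - \<theta>) * x powr (- \<theta>)"
proof -
  have "ln (x / \<theta>) \<le> x / \<theta> - 1" using assms by (intro ln_le_minus_one) simp
  hence "\<theta> * (ln x - ln \<theta>) \<le> \<theta> * (x / \<theta> - 1)"
    using assms by (intro mult_left_mono) (auto simp: ln_div)
  hence "- x \<le> \<theta> * ln \<theta> - \<theta> + - \<theta> * ln x" using assms by (simp add: algebra_simps)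
  thus ?thesis using assms unfolding powr_def by (simp flip: exp_add)
qed

lemma hyp1F1_same:
  fixes a z :: real
  assumes "a > 0"
  shows "hyp1F1 a a z = exp z"
proof -
  have "pochhammer a k / (fact k * pochhammer a k) * z ^ k = z ^ k /\<^sub>R fact k" for k
    using pochhammer_pos[OF assms, of k] by (simp add: divide_simps)
  thus ?thesis unfolding hyp1F1_def exp_def by (simp only:)
qed

text \<open>Euler's integral: \<open>Beta_mixture\<close> applied to the exponential series with p =
  a and p + \<delta> = c.\<close>

lemma hyp1F1_Beta_integral:
  fixes a c y :: real
  assumes a: "0 < a" and c: "a < c"
  defines "w \<equiv> \<lambda>t. indicator {0..1} t * (t powr (a - 1) * (1 - t) powr (c - a - 1))"
  shows "has_bochner_integral lborel (\<lambda>t. w t * exp (- y * t)) (Beta a (c - a) * hyp1F1 a c (- y))"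
proof -
  have d: "c - a > 0" using c by simp
  have B: "Beta a (c - a) > 0" using a c by (simp add: Beta_def)
  have "(\<lambda>k. \<bar>y\<bar> ^ k /\<^sub>R fact k) sums exp \<bar>y\<bar>" by (rule exp_converges)
  hence u: "summable (\<lambda>k. \<bar>1 / fact k * (- y) ^ k\<bar>)"
    by (simp add: sums_iff abs_mult power_abs field_simps)
  have e: "(\<Sum>k. 1 / fact k * (- y * t) ^ k) = exp (- y * t)" for t
    by (simp add: exp_def field_simps)
  note mix = Beta_mixture[OF a d u, unfolded e]
  have "(\<lambda>k. pochhammer a k / (fact k * pochhammer c k) * (- y) ^ k) sums
      ((\<integral>t. w t * exp (- y * t) \<partial>lborel) / Beta a (c - a))"
    unfolding w_def using mix(2) by simp
  hence "hyp1F1 a c (- y) = (\<integral>t. w t * exp (- y * t) \<partial>lborel) / Beta a (c - a)"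
    by (simp add: hyp1F1_def sums_iff)
  thus ?thesis using mix(1) B unfolding w_def by (simp add: has_bochner_integral_iff)
qed

text \<open>Bound the exponential in Euler's integral by a multiple of (y t)^(-\<theta>). The weight
  then carries t^(a - \<theta> - 1), which is still integrable at 0 because \<theta> < a.\<close>

lemma hyp1F1_powr_bound:
  fixes a c \<theta> :: real
  assumes a: "0 < a" and c: "a < c" and \<theta>: "0 < \<theta>" "\<theta> < a"
  obtains C where "C > 0" "\<And>y. y > 0 \<Longrightarrow> hyp1F1 a c (- y) \<le> C * y powr (- \<theta>)"
proof -
  define D where "D = exp (\<theta> * ln \<theta> - \<theta>)"
  define B B' where "B = Beta a (c - a)" and "B' = Beta (a - \<theta>) (c - a)"
  have B: "B > 0" "B' > 0" using a c \<theta> by (auto simp: Beta_def B_def B'_def)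
  define w where "w = (\<lambda>t::real. indicator {0..1} t * (t powr (a - 1) * (1 - t) powr (c - a - 1)))"
  define w' where "w' = (\<lambda>t::real. indicator {0..1} t * (t powr (a - \<theta> - 1) * (1 - t) powr (c - a - 1)))"
  have "hyp1F1 a c (- y) \<le> D * B' / B * y powr (- \<theta>)" if y: "y > 0" for y
  proof -
    have hb: "has_bochner_integral lborel w' B'"
    proof -
      have int: "set_integrable lborel {0..1} (\<lambda>t. t powr (a - \<theta> - 1) * (1 - t) powr (c - a - 1))"
        using \<theta> c by (intro integrable_Beta) auto
      moreover have "integral {0..1} (\<lambda>t. t powr (a - \<theta> - 1) * (1 - t) powr (c - a - 1)) = B'"
        unfolding B'_def using \<theta> c by (intro integral_unique has_integral_Beta_real) auto
      ultimately show ?thesis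
        using set_borel_integral_eq_integral(2)[OF int]
        unfolding w'_def has_bochner_integral_iff set_integrable_def set_lebesgue_integral_def
        by simp
    qed
    have le: "w t * exp (- y * t) \<le> (D * y powr (- \<theta>)) * w' t" for t
    proof (cases "t \<in> {0<..1}")
      case True
      have "exp (- (y * t)) \<le> D * (y * t) powr (- \<theta>)"
        unfolding D_def using True y \<theta> by (intro exp_minus_le_powr) auto
      hence "w t * exp (- (y * t)) \<le> w t * (D * (y * t) powr (- \<theta>))"
        by (intro mult_left_mono) (auto simp: w_def)
      also have "\<dots> = (D * y powr (- \<theta>)) * (w t * t powr (- \<theta>))"
        using True y by (simp add: powr_mult)
      also have "w t * t powr (- \<theta>) = w' t"
      proof -
        have "a - \<theta> - 1 = (a - 1) + - \<theta>" by simp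
        hence "t powr (a - \<theta> - 1) = t powr (a - 1) * t powr (- \<theta>)" by (simp only: powr_add)
        thus ?thesis by (simp add: w_def w'_def)
      qed
      finally show ?thesis by simp
    next
      case False
      hence "t = 0 \<or> t \<notin> {0..1}" by auto
      thus ?thesis by (auto simp: w_def w'_def)
    qed
    have hbw: "has_bochner_integral lborel (\<lambda>t. w t * exp (- y * t)) (B * hyp1F1 a c (- y))"
      unfolding w_def B_def by (rule hyp1F1_Beta_integral[OF a c])
    have "B * hyp1F1 a c (- y) \<le> (D * y powr (- \<theta>)) * B'"
      using hb hbw integral_mono[of lborel "\<lambda>t. w t * exp (- y * t)" "\<lambda>t. (D * y powr (- \<theta>)) * w' t"] le
      by (simp add: has_bochner_integral_iff)
    thus ?thesis using B by (simp add: field_simps)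
  qed
  moreover have "D * B' / B > 0" using B by (simp add: D_def)
  ultimately show ?thesis using that by blast
qed

lemma hyp1F2_negative_if_le:
  fixes a b c :: real
  assumes a: "a > 0" and b: "b > 0" and c: "0 < c" "c \<le> a"
  shows "\<exists>r>0. hyp1F2 a b c (- r) < 0"
proof (rule ccontr)
  assume "\<not> ?thesis"
  hence nn: "hyp1F2 a b c (- r) \<ge> 0" if "r > 0" for r using that by force
  have F: "hyp1F2 a b a (- r) \<ge> 0" if r: "r > 0" for r
  proof (cases "c = a")
    case False
    have "hyp1F2 a (c + (a - c)) b (- r) > 0"
      by (rule hyp1F2_raise[OF a c(1) b _ _ r]) (use False c nn in \<open>auto simp: hyp1F2_commute[of a c b]\<close>)
    thus ?thesis by (simp add: hyp1F2_commute[of a a b])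
  qed (use nn r in auto)
  \<comment> \<open>The Laplace transform \<open>Gamma b * s powr (-b) * exp (-1/s)\<close> of a nonnegative function would have
    to decrease in \<open>s\<close>, but it tends to \<open>0\<close> as \<open>s\<close> does.\<close>
  define G where "G = (\<lambda>s r. indicator {0<..} r * (r powr (b - 1) * exp (- s * r)) * hyp1F2 a b a (- r))"
  have G: "has_bochner_integral lborel (G s) (Gamma b / s powr b * exp (- 1 / s))" if "s > 0" for s
    unfolding G_def using Laplace_hyp1F2[OF a b a that] by (simp add: hyp1F1_same[OF a])
  have mono: "exp (-1) \<le> s powr (- b) * exp (- (1 / s))" if s: "0 < s" "s \<le> 1" for s
  proof -
    have "G 1 r \<le> G s r" for r
    proof (cases "r > 0")
      case True
      have "exp (- 1 * r) \<le> exp (- s * r)" using s True by simp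
      thus ?thesis using F[OF True] True unfolding G_def
        by (intro mult_right_mono mult_left_mono) auto
    qed (simp add: G_def)
    hence "Gamma b / 1 powr b * exp (- 1 / 1) \<le> Gamma b / s powr b * exp (- 1 / s)"
      using has_bochner_integral_integral_eq[OF G] G s
        integral_mono[of lborel "G 1" "G s"] by (auto simp: has_bochner_integral_iff)
    hence "Gamma b * exp (-1) \<le> Gamma b * (s powr (- b) * exp (- (1 / s)))"
      by (simp add: powr_minus field_simps)
    thus ?thesis using Gamma_real_pos[OF b] by simp
  qed
  \<comment> \<open>The exponent b + 1 is one more than is needed to cancel
    \<open>s powr (- b)\<close>, so the right-hand side of \<open>mono\<close> is at most D s, which
    is impossible for small s.\<close>
  define D where "D = exp ((b + 1) * ln (b + 1) - (b + 1))"
  have D: "D > 0" by (simp add: D_def)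
  have bound: "exp (-1) \<le> D * s" if s: "0 < s" "s \<le> 1" for s
  proof -
    have "exp (- (1 / s)) \<le> D * (1 / s) powr (- (b + 1))"
      unfolding D_def using s b by (intro exp_minus_le_powr) auto
    also have "(1 / s) powr (- (b + 1)) = s powr (b + 1)"
      using s by (subst powr_minus) (simp add: powr_divide)
    finally have "s powr (- b) * exp (- (1 / s)) \<le> s powr (- b) * (D * s powr (b + 1))"
      by (intro mult_left_mono) auto
    also have "\<dots> = D * s" using s by (simp add: powr_add powr_minus)
    finally show ?thesis using mono[OF s] by linarith
  qed
  define s where "s = min 1 (exp (-1) / (2 * D))"
  have s: "0 < s" "s \<le> 1" using D by (auto simp: s_def)
  have "D * s \<le> D * (exp (-1) / (2 * D))" using D by (intro mult_left_mono) (auto simp: s_def)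
  also have "\<dots> = exp (-1) / 2" using D by simp
  finally have "D * s \<le> exp (-1) / 2" .
  moreover have "exp (-1 :: real) > 0" by simp
  ultimately show False using bound[OF s] by linarith
qed

section \<open>Finite moments of a nonnegative 1F2\<close>

lemma borel_measurable_hyp1F2 [measurable]:
  fixes a b c :: real
  assumes "a > 0" "b > 0" "c > 0"
  shows "hyp1F2 a b c \<in> borel_measurable borel"
  by (intro borel_measurable_continuous_onI continuous_hyp1F2 assms)

text \<open>With l = b - q, write r^(q-1) as r^(b-1) r^(-l) and r^(-l) as an integral of u^(l-1) exp
  (-u r) over u, up to Gamma l. Nonnegativity permits exchanging the integrals, and the moment
  becomes a multiple of the integral of u^(-q-1) 1F1(a; c; -1/u).\<close>

lemma integrable_hyp1F2_moment:
  fixes a b c q :: real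
  assumes a: "a > 0" and b: "b > 0" and c: "a < c" and q: "0 < q" "q < a" "q < b"
    and F: "\<And>r. r > 0 \<Longrightarrow> hyp1F2 a b c (- r) \<ge> 0"
  shows "integrable lborel (\<lambda>r. indicator {0<..} r * (r powr (q - 1) * hyp1F2 a b c (- r)))"
proof -
  have c0: "c > 0" using a c by simp
  have [measurable]: "hyp1F2 a b c \<in> borel_measurable borel"
    using a b c0 by (rule borel_measurable_hyp1F2)
  define l where "l = b - q"
  have l: "l > 0" using q by (simp add: l_def)
  have Gl: "Gamma l > 0" using l by (rule Gamma_real_pos)
  have Gb: "Gamma b > 0" using b by (rule Gamma_real_pos)
  \<comment> \<open>Two decay rates on either side of q: the bound with \<theta>2 > q makes the
    u-integrand integrable at 0, the bound with \<theta>1 < q at infinity. The function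
    \<open>g\<close> below joins them at u = 1.\<close>
  define \<theta>1 \<theta>2 where "\<theta>1 = q / 2" and "\<theta>2 = (q + a) / 2"
  have \<theta>: "0 < \<theta>1" "\<theta>1 < q" "q < \<theta>2" "\<theta>2 < a" "\<theta>1 < a" "0 < \<theta>2"
    using q by (auto simp: \<theta>1_def \<theta>2_def)
  obtain C1 where C1: "C1 > 0" "\<And>y. y > 0 \<Longrightarrow> hyp1F1 a c (- y) \<le> C1 * y powr (- \<theta>1)"
    using hyp1F1_powr_bound[OF a c \<theta>(1,5)] by blast
  obtain C2 where C2: "C2 > 0" "\<And>y. y > 0 \<Longrightarrow> hyp1F1 a c (- y) \<le> C2 * y powr (- \<theta>2)"
    using hyp1F1_powr_bound[OF a c \<theta>(6,4)] by blast
  define A where "A = (\<lambda>r. indicator {0<..} r * (r powr (b - 1) * hyp1F2 a b c (- r)))"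
  define E where "E = (\<lambda>r u::real. indicator {0<..} u * (u powr (l - 1) * exp (- u * r)))"
  define f where "f = (\<lambda>r. indicator {0<..} r * (r powr (q - 1) * hyp1F2 a b c (- r)))"
  have A0: "A r \<ge> 0" for r using F[of r] by (cases "r > 0") (auto simp: A_def)
  have f0: "f r \<ge> 0" for r using F[of r] by (cases "r > 0") (auto simp: f_def)
  have E0: "E r u \<ge> 0" for r u by (simp add: E_def)
  \<comment> \<open>Tonelli for \<open>A r * E r u\<close>: integrating over \<open>u\<close> gives the moment, integrating over \<open>r\<close> gives
    the Laplace transform, whose behaviour at \<open>0\<close> and at infinity is known.\<close>
  have inner_u: "(\<integral>\<^sup>+u. ennreal (A r * E r u) \<partial>lborel) = ennreal (Gamma l * f r)" for r
  proof (cases "r > 0")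
    case True
    have "E r = (\<lambda>u. indicator {0<..} u * (u powr (l - 1) * exp (- r * u powr 1)))"
      by (auto simp: E_def indicator_def mult.commute)
    hence "has_bochner_integral lborel (E r) (Gamma l / r powr l)"
      using Gamma_powr_integral[OF l True zero_less_one] by simp
    hence "has_bochner_integral lborel (\<lambda>u. A r * E r u) (A r * (Gamma l / r powr l))"
      by (rule has_bochner_integral_mult_right)
    hence "(\<integral>\<^sup>+u. ennreal (A r * E r u) \<partial>lborel) = ennreal (A r * (Gamma l / r powr l))"
      using A0 E0 by (subst nn_integral_eq_integral) (auto simp: has_bochner_integral_iff)
    also have "A r * (Gamma l / r powr l) = Gamma l * f r"
    proof -
      have "q - 1 = (b - 1) - l" by (simp add: l_def)
      hence "r powr (q - 1) = r powr (b - 1) / r powr l" by (simp only: powr_diff)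
      thus ?thesis by (simp add: A_def f_def)
    qed
    finally show ?thesis .
  qed (simp add: A_def f_def)
  have inner_r: "(\<integral>\<^sup>+r. ennreal (A r * E r u) \<partial>lborel) =
      ennreal (indicator {0<..} u * (Gamma b * u powr (- q - 1) * hyp1F1 a c (- (1 / u))))" for u
  proof (cases "u > 0")
    case True
    have hb: "has_bochner_integral lborel (\<lambda>r. indicator {0<..} r * (r powr (b - 1) * exp (- u * r)) * hyp1F2 a b c (- r))
        (Gamma b / u powr b * hyp1F1 a c (- 1 / u))"
      by (rule Laplace_hyp1F2[OF a b c0 True])
    have "A r * E r u = u powr (l - 1) * (indicator {0<..} r * (r powr (b - 1) * exp (- u * r)) * hyp1F2 a b c (- r))" for r
      using True by (simp add: A_def E_def)
    hence "has_bochner_integral lborel (\<lambda>r. A r * E r u)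
        (u powr (l - 1) * (Gamma b / u powr b * hyp1F1 a c (- 1 / u)))"
      using has_bochner_integral_mult_right[OF hb, of "u powr (l - 1)"] by simp
    hence "(\<integral>\<^sup>+r. ennreal (A r * E r u) \<partial>lborel) =
        ennreal (u powr (l - 1) * (Gamma b / u powr b * hyp1F1 a c (- 1 / u)))"
      using A0 E0 by (subst nn_integral_eq_integral) (auto simp: has_bochner_integral_iff)
    also have "u powr (l - 1) * (Gamma b / u powr b * hyp1F1 a c (- 1 / u)) =
        Gamma b * u powr (- q - 1) * hyp1F1 a c (- (1 / u))"
    proof -
      have "- q - 1 = (l - 1) - b" by (simp add: l_def)
      hence "u powr (- q - 1) = u powr (l - 1) / u powr b" by (simp only: powr_diff)
      thus ?thesis by simp
    qed
    finally show ?thesis using True by simp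
  qed (simp add: E_def)
  define g where "g = (\<lambda>u::real. ennreal (Gamma b * C2) * (indicator {0..1} u * ennreal (u powr (\<theta>2 - q - 1))) +
     ennreal (Gamma b * C1) * (indicator {1..} u * ennreal (u powr (\<theta>1 - q - 1))))"
  have hyp_le: "Gamma b * u powr (- q - 1) * hyp1F1 a c (- (1 / u)) \<le> Gamma b * C * u powr (\<theta> - q - 1)"
    if u: "u > 0" and C: "\<And>y. y > 0 \<Longrightarrow> hyp1F1 a c (- y) \<le> C * y powr (- \<theta>)" for u C \<theta>
  proof -
    have "hyp1F1 a c (- (1 / u)) \<le> C * (1 / u) powr (- \<theta>)" using u by (intro C) simp
    also have "(1 / u) powr (- \<theta>) = u powr \<theta>"
      using u by (subst powr_minus) (simp add: powr_divide)
    finally have "Gamma b * u powr (- q - 1) * hyp1F1 a c (- (1 / u)) \<le>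
        Gamma b * u powr (- q - 1) * (C * u powr \<theta>)"
      using Gb by (intro mult_left_mono) auto
    also have "\<dots> = Gamma b * C * (u powr \<theta> * u powr (- q - 1))" by (simp add: mult_ac)
    also have "u powr \<theta> * u powr (- q - 1) = u powr (\<theta> - q - 1)" by (simp add: add_diff_eq flip: powr_add)
    finally show ?thesis .
  qed
  have le_g: "ennreal (indicator {0<..} u * (Gamma b * u powr (- q - 1) * hyp1F1 a c (- (1 / u)))) \<le> g u" for u
  proof (cases "u > 0")
    case True
    show ?thesis
    proof (cases "u \<le> 1")
      case True1: True
      have "ennreal (indicator {0<..} u * (Gamma b * u powr (- q - 1) * hyp1F1 a c (- (1 / u)))) \<le>
          ennreal (Gamma b * C2 * u powr (\<theta>2 - q - 1))"
        using hyp_le[OF True C2(2)] True by (intro ennreal_leI) simp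
      also have "\<dots> \<le> g u"
        using True True1 Gb C2(1) by (simp add: g_def ennreal_mult')
      finally show ?thesis .
    next
      case False
      have "ennreal (indicator {0<..} u * (Gamma b * u powr (- q - 1) * hyp1F1 a c (- (1 / u)))) \<le>
          ennreal (Gamma b * C1 * u powr (\<theta>1 - q - 1))"
        using hyp_le[OF True C1(2)] True by (intro ennreal_leI) simp
      also have "\<dots> \<le> g u"
        using True False Gb C1(1) by (simp add: g_def ennreal_mult')
      finally show ?thesis .
    qed
  qed simp
  have g_fin: "(\<integral>\<^sup>+u. g u \<partial>lborel) < \<infinity>"
  proof -
    have "((\<lambda>u::real. u powr (\<theta>2 - q - 1)) has_integral 1 powr (\<theta>2 - q - 1 + 1) / (\<theta>2 - q - 1 + 1)) {0..1}"
      using \<theta> by (intro has_integral_powr_from_0) auto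
    from nn_integral_has_integral_lebesgue[OF _ this]
    have i1: "(\<integral>\<^sup>+u. indicator {0..1} u * ennreal (u powr (\<theta>2 - q - 1)) \<partial>lborel) < \<infinity>"
      by (simp add: ennreal_mult' ennreal_indicator)
    have "((\<lambda>u::real. u powr (\<theta>1 - q - 1)) has_integral - (1 powr (\<theta>1 - q - 1 + 1)) / (\<theta>1 - q - 1 + 1)) {1..}"
      using \<theta> by (intro has_integral_powr_to_inf) auto
    from nn_integral_has_integral_lebesgue[OF _ this]
    have i2: "(\<integral>\<^sup>+u. indicator {1..} u * ennreal (u powr (\<theta>1 - q - 1)) \<partial>lborel) < \<infinity>"
      by (simp add: ennreal_mult' ennreal_indicator)
    show ?thesis unfolding g_def using i1 i2
      by (subst nn_integral_add) (auto simp: nn_integral_cmult ennreal_mult_less_top)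
  qed
  have "(\<integral>\<^sup>+r. ennreal (Gamma l * f r) \<partial>lborel) = (\<integral>\<^sup>+r. (\<integral>\<^sup>+u. ennreal (A r * E r u) \<partial>lborel) \<partial>lborel)"
    by (simp only: inner_u)
  also have "\<dots> = (\<integral>\<^sup>+u. (\<integral>\<^sup>+r. ennreal (A r * E r u) \<partial>lborel) \<partial>lborel)"
    by (rule lborel_pair.Fubini') (simp add: A_def E_def split_beta')
  also have "\<dots> \<le> (\<integral>\<^sup>+u. g u \<partial>lborel)"
    unfolding inner_r by (intro nn_integral_mono le_g)
  also note g_fin
  finally have "(\<integral>\<^sup>+r. ennreal (Gamma l * f r) \<partial>lborel) < \<infinity>" .
  hence "integrable lborel (\<lambda>r. Gamma l * f r)"
    using f0 Gl by (intro integrableI_nonneg) (auto simp: f_def)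
  thus ?thesis using Gl unfolding f_def by simp
qed

section \<open>Holomorphy of Laplace transforms\<close>

lemma sum_power_fact_le_exp:
  fixes x :: real
  assumes "x \<ge> 0"
  shows "(\<Sum>k<n. x ^ k / fact k) \<le> exp x"
proof -
  have "(\<lambda>k. x ^ k /\<^sub>R fact k) sums exp x" by (rule exp_converges)
  hence "(\<lambda>k. x ^ k / fact k) sums exp x" by (simp add: field_simps)
  thus ?thesis using sum_le_suminf[of "\<lambda>k. x ^ k / fact k" "{..<n}"] assms by (simp add: sums_iff)
qed

text \<open>Expand the kernel in powers of s - s0 for real s0 > 0. For |s - s0| = \<rho> < s0 the
  absolute values of the terms sum to A exp (-(s0 - \<rho>) \<phi>), which is integrable, so the
  transform is a power series on the disc of radius s0 about s0. These discs cover the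
  half-plane.\<close>

lemma Laplace_transform_holomorphic:
  fixes A \<phi> :: "real \<Rightarrow> real"
  assumes [measurable]: "A \<in> borel_measurable borel" "\<phi> \<in> borel_measurable borel"
    and A0: "\<And>r. A r \<ge> 0" and \<phi>0: "\<And>r. \<phi> r \<ge> 0"
    and int: "\<And>\<sigma>. \<sigma> > 0 \<Longrightarrow> integrable lborel (\<lambda>r. A r * exp (- \<sigma> * \<phi> r))"
  shows "(\<lambda>s. \<integral>r. of_real (A r) * exp (- s * of_real (\<phi> r)) \<partial>lborel) holomorphic_on {s. Re s > 0}"
    (is "?L holomorphic_on _")
proof -
  have ball: "?L holomorphic_on ball (of_real s0) s0" if s0: "s0 > 0" for s0
  proof -
    define e where "e = (\<lambda>k r. A r * exp (- s0 * \<phi> r) * (\<phi> r ^ k / fact k))"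
    have e0: "e k r \<ge> 0" for k r using A0 \<phi>0 by (simp add: e_def)
    have e_sum: "(\<Sum>k<n. \<rho> ^ k * e k r) \<le> A r * exp (- (s0 - \<rho>) * \<phi> r)" if "\<rho> \<ge> 0" for n r \<rho>
    proof -
      have "(\<Sum>k<n. \<rho> ^ k * e k r) = A r * exp (- s0 * \<phi> r) * (\<Sum>k<n. (\<rho> * \<phi> r) ^ k / fact k)"
        unfolding sum_distrib_left by (intro sum.cong) (auto simp: e_def power_mult_distrib)
      also have "\<dots> \<le> A r * exp (- s0 * \<phi> r) * exp (\<rho> * \<phi> r)"
        using A0 \<phi>0 that by (intro mult_left_mono sum_power_fact_le_exp) auto
      also have "\<dots> = A r * exp (- (s0 - \<rho>) * \<phi> r)"
        by (simp add: mult.assoc algebra_simps flip: exp_add)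
      finally show ?thesis .
    qed
    have e_int: "integrable lborel (e k)" for k
    proof -
      \<comment> \<open>Any radius strictly between 0 and s0 serves here: a single term is dominated
        by the partial sum containing it, which \<open>e_sum\<close> bounds.\<close>
      define \<rho> where "\<rho> = s0 / 2"
      have \<rho>: "\<rho> > 0" "s0 - \<rho> > 0" using s0 by (auto simp: \<rho>_def)
      have "integrable lborel (\<lambda>r. \<rho> ^ k * e k r)"
      proof (rule Bochner_Integration.integrable_bound[OF int[OF \<rho>(2)]])
        show "AE r in lborel. norm (\<rho> ^ k * e k r) \<le> norm (A r * exp (- (s0 - \<rho>) * \<phi> r))"
        proof (intro AE_I2)
          fix r
          have "\<rho> ^ k * e k r \<le> (\<Sum>j<Suc k. \<rho> ^ j * e j r)"
            using \<rho> e0 by (simp add: sum_nonneg)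
          also have "\<dots> \<le> A r * exp (- (s0 - \<rho>) * \<phi> r)" using \<rho> by (intro e_sum) auto
          finally show "norm (\<rho> ^ k * e k r) \<le> norm (A r * exp (- (s0 - \<rho>) * \<phi> r))"
            using e0[of k r] A0[of r] \<rho> by (simp add: abs_mult)
        qed
      qed (simp add: e_def)
      thus ?thesis using \<rho> by simp
    qed
    define c where "c = (\<lambda>k. of_real ((-1) ^ k * (\<integral>r. e k r \<partial>lborel)) :: complex)"
    have "(\<lambda>k. c k * (z - of_real s0) ^ k) sums ?L z" if z: "z \<in> ball (of_real s0) s0" for z
    proof -
      define \<rho> where "\<rho> = norm (z - of_real s0)"
      have \<rho>: "\<rho> \<ge> 0" "s0 - \<rho> > 0" using z by (auto simp: \<rho>_def dist_norm norm_minus_commute)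
      define f where "f = (\<lambda>k r. (of_real s0 - z) ^ k * complex_of_real (e k r))"
      have f_norm: "norm (f k r) = \<rho> ^ k * e k r" for k r
        using e0[of k r] by (simp add: f_def \<rho>_def norm_mult norm_power norm_minus_commute)
      have f_sums: "(\<lambda>k. f k r) sums (of_real (A r) * exp (- z * of_real (\<phi> r)))" for r
      proof -
        have "(\<lambda>k. ((of_real s0 - z) * of_real (\<phi> r)) ^ k /\<^sub>R fact k) sums exp ((of_real s0 - z) * of_real (\<phi> r))"
          by (rule exp_converges)
        from sums_mult[OF this, of "of_real (A r * exp (- s0 * \<phi> r))"]
        have "(\<lambda>k. of_real (A r * exp (- s0 * \<phi> r)) * (((of_real s0 - z) * of_real (\<phi> r)) ^ k /\<^sub>R fact k)) sums
          (of_real (A r * exp (- s0 * \<phi> r)) * exp ((of_real s0 - z) * of_real (\<phi> r)))" .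
        moreover have "of_real (A r * exp (- s0 * \<phi> r)) * (((of_real s0 - z) * of_real (\<phi> r)) ^ k /\<^sub>R fact k) = f k r" for k
          unfolding f_def e_def power_mult_distrib by (simp add: scaleR_conv_of_real divide_inverse mult_ac)
        moreover have "of_real (A r * exp (- s0 * \<phi> r)) * exp ((of_real s0 - z) * of_real (\<phi> r)) =
            of_real (A r) * exp (- z * of_real (\<phi> r))"
          by (simp add: exp_of_real[symmetric] mult.assoc algebra_simps flip: exp_add)
        ultimately show ?thesis by (simp only:)
      qed
      have f_int: "integrable lborel (f k)" for k
        unfolding f_def by (intro integrable_mult_right integrable_of_real e_int)
      have pt: "summable (\<lambda>k. norm (f k r))" for r
        unfolding f_norm
        by (rule summableI_nonneg_bounded[where x = "A r * exp (- (s0 - \<rho>) * \<phi> r)"])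
           (use e0 \<rho> e_sum[OF \<rho>(1)] in auto)
      have "summable (\<lambda>k. \<integral>r. norm (f k r) \<partial>lborel)"
        unfolding f_norm
      proof (rule summableI_nonneg_bounded[where x = "\<integral>r. A r * exp (- (s0 - \<rho>) * \<phi> r) \<partial>lborel"])
        fix n
        show "0 \<le> (\<integral>r. \<rho> ^ n * e n r \<partial>lborel)" using e0 \<rho> by (intro integral_nonneg_AE) auto
        have "(\<Sum>k<n. \<integral>r. \<rho> ^ k * e k r \<partial>lborel) = (\<integral>r. (\<Sum>k<n. \<rho> ^ k * e k r) \<partial>lborel)"
          using e_int by (subst Bochner_Integration.integral_sum) auto
        also have "\<dots> \<le> (\<integral>r. A r * exp (- (s0 - \<rho>) * \<phi> r) \<partial>lborel)"
          using e_int int[OF \<rho>(2)] e_sum[OF \<rho>(1)] by (intro integral_mono) auto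
        finally show "(\<Sum>k<n. \<integral>r. \<rho> ^ k * e k r \<partial>lborel) \<le> (\<integral>r. A r * exp (- (s0 - \<rho>) * \<phi> r) \<partial>lborel)" .
      qed
      from sums_integral[OF f_int _ this] pt
      have "(\<lambda>k. \<integral>r. f k r \<partial>lborel) sums (\<integral>r. (\<Sum>k. f k r) \<partial>lborel)" by simp
      moreover have "(\<Sum>k. f k r) = of_real (A r) * exp (- z * of_real (\<phi> r))" for r
        using f_sums by (simp add: sums_iff)
      moreover have "(\<integral>r. f k r \<partial>lborel) = c k * (z - of_real s0) ^ k" for k
      proof -
        have "(of_real s0 - z) ^ k = (-1) ^ k * (z - of_real s0) ^ k"
          by (simp flip: power_mult_distrib)
        thus ?thesis unfolding f_def c_def by (simp add: mult_ac)
      qed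
      ultimately show ?thesis by simp
    qed
    thus ?thesis by (rule power_series_holomorphic)
  qed
  have "\<exists>s0>0. z \<in> ball (of_real s0) s0" if "Re z > 0" for z
  proof -
    \<comment> \<open>With this centre, |z - s0|^2 = s0^2 - |z|^2, so z lies inside the
      disc.\<close>
    define s0 where "s0 = (norm z)\<^sup>2 / Re z"
    have "norm z > 0" using that by auto
    hence s0: "s0 > 0" using that by (simp add: s0_def)
    have "(norm (z - of_real s0))\<^sup>2 = (norm z)\<^sup>2 - 2 * s0 * Re z + s0\<^sup>2"
      unfolding cmod_power2 by (simp add: power2_eq_square algebra_simps)
    also have "\<dots> = s0\<^sup>2 - (norm z)\<^sup>2" using that by (simp add: s0_def)
    also have "\<dots> < s0\<^sup>2" using \<open>norm z > 0\<close> by simp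
    finally have "norm (z - of_real s0) < s0" using s0 by (simp add: power_less_imp_less_base)
    thus ?thesis using s0 by (auto simp: dist_norm norm_minus_commute)
  qed
  hence "{s. Re s > 0} \<subseteq> (\<Union>s0\<in>{0<..}. ball (of_real s0) s0)" by force
  moreover have "?L holomorphic_on (\<Union>s0\<in>{0<..}. ball (of_real s0) s0)"
    using ball by (intro holomorphic_on_UN_open) auto
  ultimately show ?thesis using holomorphic_on_subset by blast
qed

text \<open>By Gauss's limit for Gamma, (z)_(n+1) behaves like n! n^z / Gamma z. The balance a +
  \<beta> = c + \<gamma> cancels the powers of n.\<close>

lemma pochhammer_ratio_tendsto:
  fixes a \<beta> c \<gamma> :: real
  assumes pos: "a > 0" "\<beta> > 0" "c > 0" "\<gamma> > 0" and eq: "a + \<beta> = c + \<gamma>"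
  shows "(\<lambda>k. pochhammer a k * pochhammer \<beta> k / (pochhammer c k * pochhammer \<gamma> k)) \<longlonglongrightarrow>
           Gamma c * Gamma \<gamma> / (Gamma a * Gamma \<beta>)"
proof -
  define G where "G = (\<lambda>z n. Gamma_series (z::real) n)"
  have lim: "G z \<longlonglongrightarrow> Gamma z" for z unfolding G_def by (rule Gamma_series_LIMSEQ)
  \<comment> \<open>\<open>Gamma_series z n\<close> contains the Pochhammer symbol of length n + 1;
    hence the shift of the index here and in the final step.\<close>
  have po: "pochhammer z (Suc n) = fact n * exp (z * ln (real n)) / G z n" if "z > 0" for z n
    using pochhammer_pos[OF that, of "Suc n"] by (simp add: G_def Gamma_series_def)
  have "pochhammer a (Suc n) * pochhammer \<beta> (Suc n) / (pochhammer c (Suc n) * pochhammer \<gamma> (Suc n)) =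
      G c n * G \<gamma> n / (G a n * G \<beta> n)" for n
  proof -
    have "exp (a * ln (real n)) * exp (\<beta> * ln (real n)) = exp (c * ln (real n)) * exp (\<gamma> * ln (real n))"
      using eq by (simp flip: exp_add distrib_right)
    hence "fact n * exp (a * ln (real n)) * (fact n * exp (\<beta> * ln (real n))) =
        fact n * exp (c * ln (real n)) * (fact n * exp (\<gamma> * ln (real n)))" by simp
    moreover have "fact n * exp (c * ln (real n)) * (fact n * exp (\<gamma> * ln (real n))) \<noteq> 0" by simp
    moreover have "x / p * (y / q) / (z / r * (w / s)) = r * s / (p * q)"
      if "x * y = z * w" "z * w \<noteq> 0" for x y z w p q r s :: real
    proof -
      have "x / p * (y / q) / (z / r * (w / s)) = (x * y) / (z * w) * (r * s / (p * q))"
        by (simp add: mult_ac)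
      thus ?thesis using that by simp
    qed
    ultimately show ?thesis
      unfolding po[OF pos(1)] po[OF pos(2)] po[OF pos(3)] po[OF pos(4)] by blast
  qed
  moreover have "(\<lambda>n. G c n * G \<gamma> n / (G a n * G \<beta> n)) \<longlonglongrightarrow> Gamma c * Gamma \<gamma> / (Gamma a * Gamma \<beta>)"
    using Gamma_real_pos[OF pos(1)] Gamma_real_pos[OF pos(2)]
    by (intro tendsto_intros lim) auto
  ultimately show ?thesis
    by (subst filterlim_sequentially_Suc[symmetric]) simp
qed

lemma binomial_pochhammer_sums:
  fixes \<gamma> :: real and w :: complex
  assumes "norm w < 1"
  shows "(\<lambda>k. of_real (pochhammer \<gamma> k / fact k) * w ^ k) sums ((1 - w) powr (- of_real \<gamma>))"
proof -
  have "(\<lambda>k. ((- of_real \<gamma>) gchoose k) * (- w) ^ k) sums (1 + - w) powr (- of_real \<gamma>)"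
    using assms by (intro gen_binomial_complex) simp
  moreover have "((- of_real \<gamma>) gchoose k) * (- w) ^ k = of_real (pochhammer \<gamma> k / fact k) * w ^ k" for k
  proof -
    have "((- of_real \<gamma>) gchoose k) * (- w) ^ k =
        ((-1) ^ k * (-1) ^ k) * (pochhammer (of_real \<gamma>) k / fact k * w ^ k)"
      unfolding gbinomial_pochhammer power_minus[of w] by simp
    also have "(-1) ^ k * (-1) ^ k = (1 :: complex)" by (simp flip: power_mult_distrib)
    finally show ?thesis by (simp add: pochhammer_of_real)
  qed
  ultimately show ?thesis by simp
qed

subsection \<open>Resonance at the singularity of the transform\<close>

definition hyp2F1 :: "real \<Rightarrow> real \<Rightarrow> real \<Rightarrow> complex \<Rightarrow> complex" where
  "hyp2F1 a \<beta> c w = (\<Sum>k. of_real (pochhammer a k * pochhammer \<beta> k / (fact k * pochhammer c k)) * w ^ k)"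

lemma summable_binomial_pochhammer:
  fixes \<gamma> x :: real
  assumes "0 \<le> x" "x < 1"
  shows "summable (\<lambda>k. pochhammer \<gamma> k / fact k * x ^ k)"
    and "(\<Sum>k. pochhammer \<gamma> k / fact k * x ^ k) = (1 - x) powr (- \<gamma>)"
proof -
  have "(\<lambda>k. of_real (pochhammer \<gamma> k / fact k) * (of_real x) ^ k) sums
      ((1 - complex_of_real x) powr (- of_real \<gamma>))"
    using assms by (intro binomial_pochhammer_sums) simp
  also have "(\<lambda>k. complex_of_real (pochhammer \<gamma> k / fact k) * (of_real x) ^ k) =
      (\<lambda>k. of_real (pochhammer \<gamma> k / fact k * x ^ k))" by simp
  also have "(1 - complex_of_real x) powr (- of_real \<gamma>) = of_real ((1 - x) powr (- \<gamma>))"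
    using assms by (simp add: powr_of_real[symmetric])
  finally have "(\<lambda>k. pochhammer \<gamma> k / fact k * x ^ k) sums ((1 - x) powr (- \<gamma>))"
    by (simp only: sums_of_real_iff)
  thus "summable (\<lambda>k. pochhammer \<gamma> k / fact k * x ^ k)"
    and "(\<Sum>k. pochhammer \<gamma> k / fact k * x ^ k) = (1 - x) powr (- \<gamma>)"
    by (auto simp: sums_iff)
qed

text \<open>The comparison sequence consists of the coefficients of (1 - w)^(-\<gamma>) with
  \<gamma> = a + \<beta> - c, which identifies \<gamma> as the order of the singularity at w =
  1.\<close>

lemma hyp2F1_coeff_ratio:
  fixes a \<beta> c :: real
  assumes pos: "a > 0" "\<beta> > 0" "c > 0" and lt: "c < a + \<beta>"
  shows "(\<lambda>k. (pochhammer a k * pochhammer \<beta> k / (fact k * pochhammer c k)) / (pochhammer (a + \<beta> - c) k / fact k))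
    \<longlonglongrightarrow> Gamma c * Gamma (a + \<beta> - c) / (Gamma a * Gamma \<beta>)"
  using pochhammer_ratio_tendsto[of a \<beta> c "a + \<beta> - c"] assms by (simp add: mult_ac)

lemma summable_hyp2F1:
  fixes a \<beta> c x :: real
  assumes pos: "a > 0" "\<beta> > 0" "c > 0" and lt: "c < a + \<beta>" and x: "0 \<le> x" "x < 1"
  shows "summable (\<lambda>k. pochhammer a k * pochhammer \<beta> k / (fact k * pochhammer c k) * x ^ k)"
proof -
  define v g where "v = (\<lambda>k. pochhammer a k * pochhammer \<beta> k / (fact k * pochhammer c k))"
    and "g = (\<lambda>k. pochhammer (a + \<beta> - c) k / fact k)"
  have vg: "v k > 0" "g k > 0" for k
    using pos lt by (auto simp: v_def g_def intro!: divide_pos_pos mult_pos_pos pochhammer_pos)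
  have "(\<lambda>k. v k / g k) \<longlonglongrightarrow> Gamma c * Gamma (a + \<beta> - c) / (Gamma a * Gamma \<beta>)"
    unfolding v_def g_def by (rule hyp2F1_coeff_ratio[OF pos lt])
  hence "Bseq (\<lambda>k. v k / g k)" using convergent_imp_Bseq convergentI by blast
  then obtain M where M: "\<And>k. norm (v k / g k) \<le> M" by (auto simp: Bseq_def)
  have "summable (\<lambda>k. M * (g k * x ^ k))"
    unfolding g_def by (intro summable_mult summable_binomial_pochhammer x)
  hence "summable (\<lambda>k. v k * x ^ k)"
  proof (rule summable_comparison_test'[where N = 0])
    fix k
    have "v k \<le> M * g k" using M[of k] vg[of k] by (simp add: pos_divide_le_eq)
    hence "v k * x ^ k \<le> M * g k * x ^ k" using x by (intro mult_right_mono) auto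
    thus "norm (v k * x ^ k) \<le> M * (g k * x ^ k)" using vg[of k] x by (simp add: abs_mult mult_ac)
  qed
  thus ?thesis unfolding v_def .
qed

lemma hyp2F1_sums:
  fixes a \<beta> c :: real and w :: complex
  assumes pos: "a > 0" "\<beta> > 0" "c > 0" and lt: "c < a + \<beta>" and w: "norm w < 1"
  shows "(\<lambda>k. of_real (pochhammer a k * pochhammer \<beta> k / (fact k * pochhammer c k)) * w ^ k)
           sums hyp2F1 a \<beta> c w"
proof -
  have "0 < pochhammer a k * pochhammer \<beta> k / (fact k * pochhammer c k)" for k
    using pos by (auto intro!: divide_pos_pos mult_pos_pos pochhammer_pos)
  hence "norm (of_real (pochhammer a k * pochhammer \<beta> k / (fact k * pochhammer c k)) * w ^ k) =
      pochhammer a k * pochhammer \<beta> k / (fact k * pochhammer c k) * norm w ^ k" for k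
    unfolding norm_mult norm_power norm_of_real by (simp only: abs_of_pos)
  hence "summable (\<lambda>k. norm (of_real (pochhammer a k * pochhammer \<beta> k / (fact k * pochhammer c k)) * w ^ k))"
    using summable_hyp2F1[OF pos lt norm_ge_zero w] by simp
  thus ?thesis unfolding hyp2F1_def by (rule summable_sums[OF summable_norm_cancel])
qed

lemma hyp2F1_holomorphic:
  fixes a \<beta> c :: real
  assumes "a > 0" "\<beta> > 0" "c > 0" "c < a + \<beta>"
  shows "hyp2F1 a \<beta> c holomorphic_on ball 0 1"
proof (rule power_series_holomorphic)
  fix w :: complex assume "w \<in> ball 0 1"
  thus "(\<lambda>k. of_real (pochhammer a k * pochhammer \<beta> k / (fact k * pochhammer c k)) * (w - 0) ^ k)
      sums hyp2F1 a \<beta> c w"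
    using hyp2F1_sums[OF assms, of w] by simp
qed

text \<open>An Abelian argument: the coefficients are asymptotic to those of a multiple of
  \<open>(1 - w) powr (- \<gamma>)\<close>, and in a cone at \<open>1\<close> the error is of smaller order.\<close>

lemma hyp2F1_lower_bound:
  fixes a \<beta> c :: real
  assumes pos: "a > 0" "\<beta> > 0" "c > 0" and lt: "c < a + \<beta>"
  obtains \<kappa> C where "\<kappa> > 0" "C \<ge> 0"
    "\<And>w. norm w < 1 \<Longrightarrow> norm (1 - w) \<le> 2 * (1 - norm w) \<Longrightarrow>
       norm (hyp2F1 a \<beta> c w) \<ge> \<kappa> * norm (1 - w) powr (- (a + \<beta> - c)) - C"
proof -
  define \<gamma> where "\<gamma> = a + \<beta> - c"
  have \<gamma>: "\<gamma> > 0" using lt by (simp add: \<gamma>_def)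
  define v g where "v = (\<lambda>k. pochhammer a k * pochhammer \<beta> k / (fact k * pochhammer c k))"
    and "g = (\<lambda>k. pochhammer \<gamma> k / fact k)"
  have vg: "v k > 0" "g k > 0" for k
    using pos \<gamma> by (auto simp: v_def g_def intro!: divide_pos_pos mult_pos_pos pochhammer_pos)
  define \<kappa> where "\<kappa> = Gamma c * Gamma \<gamma> / (Gamma a * Gamma \<beta>)"
  have \<kappa>: "\<kappa> > 0" using pos \<gamma> by (simp add: \<kappa>_def Gamma_real_pos)
  have lim: "(\<lambda>k. v k / g k) \<longlonglongrightarrow> \<kappa>"
    unfolding v_def g_def \<kappa>_def \<gamma>_def by (rule hyp2F1_coeff_ratio[OF pos lt])
  \<comment> \<open>In the cone, 1 - |w| >= |1 - w| / 2 costs a factor 2^\<gamma>; with this choice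
    the error of the tail still takes only half of the leading term.\<close>
  define \<epsilon> where "\<epsilon> = \<kappa> / (2 * 2 powr \<gamma>)"
  have \<epsilon>: "\<epsilon> > 0" using \<kappa> by (simp add: \<epsilon>_def)
  obtain N where N: "\<And>k. k \<ge> N \<Longrightarrow> \<bar>v k / g k - \<kappa>\<bar> < \<epsilon>"
    using lim \<epsilon> unfolding LIMSEQ_def dist_real_def by blast
  \<comment> \<open>The finitely many terms before the asymptotics sets in contribute a bounded
    error, since |w| < 1.\<close>
  define C where "C = (\<Sum>k<N. \<bar>v k - \<kappa> * g k\<bar>)"
  have bound: "\<kappa> / 2 * norm (1 - w) powr (- \<gamma>) - C \<le> norm (hyp2F1 a \<beta> c w)"
    if w: "norm w < 1" and cone: "norm (1 - w) \<le> 2 * (1 - norm w)" for w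
  proof -
    define x where "x = norm w"
    have x: "0 \<le> x" "x < 1" using w by (auto simp: x_def)
    define d where "d = (\<lambda>k. of_real (v k - \<kappa> * g k) * w ^ k)"
    have g1: "(\<lambda>k. of_real (g k) * w ^ k) sums ((1 - w) powr (- of_real \<gamma>))"
      unfolding g_def by (rule binomial_pochhammer_sums[OF w])
    have v1: "(\<lambda>k. of_real (v k) * w ^ k) sums hyp2F1 a \<beta> c w"
      unfolding v_def by (rule hyp2F1_sums[OF pos lt w])
    have d1: "d sums (hyp2F1 a \<beta> c w - of_real \<kappa> * (1 - w) powr (- of_real \<gamma>))"
      using sums_diff[OF v1 sums_mult[OF g1, of "of_real \<kappa>"]] by (simp add: d_def algebra_simps)
    define h where "h = (\<lambda>k. (if k < N then \<bar>v k - \<kappa> * g k\<bar> else 0) + \<epsilon> * (g k * x ^ k))"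
    have dh: "norm (d k) \<le> h k" for k
    proof -
      have nd: "norm (d k) = \<bar>v k - \<kappa> * g k\<bar> * x ^ k"
        unfolding d_def norm_mult norm_power norm_of_real x_def ..
      have gx: "0 \<le> \<epsilon> * (g k * x ^ k)" using \<epsilon> vg[of k] x by simp
      show ?thesis
      proof (cases "k < N")
        case True
        have "\<bar>v k - \<kappa> * g k\<bar> * x ^ k \<le> \<bar>v k - \<kappa> * g k\<bar> * 1"
          using x by (intro mult_left_mono power_le_one) auto
        thus ?thesis using True gx by (simp add: nd h_def)
      next
        case False
        have "\<bar>v k - \<kappa> * g k\<bar> = \<bar>v k / g k - \<kappa>\<bar> * g k"
        proof -
          have "v k - \<kappa> * g k = (v k / g k - \<kappa>) * g k" using vg[of k] by (simp add: left_diff_distrib)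
          thus ?thesis using vg[of k] by (simp add: abs_mult)
        qed
        also have "\<dots> \<le> \<epsilon> * g k" using N[of k] False vg[of k] by (intro mult_right_mono) auto
        finally have "\<bar>v k - \<kappa> * g k\<bar> * x ^ k \<le> \<epsilon> * g k * x ^ k" using x by (intro mult_right_mono) auto
        thus ?thesis using False by (simp add: nd h_def mult_ac)
      qed
    qed
    have "(\<lambda>k. g k * x ^ k) sums ((1 - x) powr (- \<gamma>))"
      unfolding g_def using summable_binomial_pochhammer[OF x, of \<gamma>] by (simp add: sums_iff)
    hence h1: "h sums (C + \<epsilon> * (1 - x) powr (- \<gamma>))"
      unfolding h_def C_def using sums_If_finite_set[of "{..<N}" "\<lambda>k. \<bar>v k - \<kappa> * g k\<bar>"]
      by (intro sums_add sums_mult) (simp_all add: lessThan_def)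
    have nd: "summable (\<lambda>k. norm (d k))"
      by (rule summable_comparison_test'[where N = 0 and g = h]) (use h1 dh in \<open>auto simp: sums_iff\<close>)
    have "norm (hyp2F1 a \<beta> c w - of_real \<kappa> * (1 - w) powr (- of_real \<gamma>)) = norm (suminf d)"
      using d1 by (simp add: sums_iff)
    also have "\<dots> \<le> (\<Sum>k. norm (d k))" by (rule summable_norm[OF nd])
    also have "\<dots> \<le> suminf h" using dh nd h1 by (intro suminf_le) (auto simp: sums_iff)
    also have "\<dots> = C + \<epsilon> * (1 - x) powr (- \<gamma>)" using h1 by (simp add: sums_iff)
    also have "\<dots> \<le> C + \<kappa> / 2 * norm (1 - w) powr (- \<gamma>)"
    proof -
      have "norm (1 - w) > 0" using w by auto
      have "(1 - x) powr (- \<gamma>) = 2 powr \<gamma> * (2 * (1 - x)) powr (- \<gamma>)"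
      proof -
        have "(2 * (1 - x)) powr (- \<gamma>) = 2 powr (- \<gamma>) * (1 - x) powr (- \<gamma>)"
          by (rule powr_mult)
        thus ?thesis by (simp only: powr_minus) simp
      qed
      also have "\<dots> \<le> 2 powr \<gamma> * norm (1 - w) powr (- \<gamma>)"
        using cone \<open>norm (1 - w) > 0\<close> \<gamma> unfolding x_def
        by (intro mult_left_mono powr_mono2') auto
      finally have "\<epsilon> * (1 - x) powr (- \<gamma>) \<le> \<epsilon> * (2 powr \<gamma> * norm (1 - w) powr (- \<gamma>))"
        using \<epsilon> by (intro mult_left_mono) auto
      also have "\<dots> = \<kappa> / 2 * norm (1 - w) powr (- \<gamma>)" by (simp add: \<epsilon>_def)
      finally show ?thesis by simp
    qed
    finally have *: "norm (hyp2F1 a \<beta> c w - of_real \<kappa> * (1 - w) powr (- of_real \<gamma>)) \<le>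
        C + \<kappa> / 2 * norm (1 - w) powr (- \<gamma>)" .
    have "norm (of_real \<kappa> * (1 - w) powr (- of_real \<gamma>)) = \<kappa> * norm (1 - w) powr (- \<gamma>)"
      using \<kappa> norm_powr_real_powr'[of "- complex_of_real \<gamma>" "1 - w"] by (simp add: norm_mult)
    hence "\<kappa> * norm (1 - w) powr (- \<gamma>) \<le> norm (hyp2F1 a \<beta> c w) +
        norm (hyp2F1 a \<beta> c w - of_real \<kappa> * (1 - w) powr (- of_real \<gamma>))"
      by (metis norm_triangle_sub norm_minus_commute)
    with * show ?thesis by simp
  qed
  show ?thesis
  proof (rule that)
    show "\<kappa> / 2 > 0" using \<kappa> by simp
    show "C \<ge> 0" by (simp add: C_def sum_nonneg)
  qed (use bound in \<open>simp add: \<gamma>_def\<close>)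
qed

text \<open>For the kernel with m = 1/2 the moments are Gamma (2 b + 2 k) = Gamma (2 b) 4^k (b)_k (b
  + 1/2)_k. Here (b)_k cancels a lower parameter, (b + 1/2)_k becomes a new upper one, and 4^k is
  absorbed by (2 s)^(2 k). The resulting 2F1 series is used inside its disc of convergence, hence s
  > 1.\<close>

lemma Laplace_sqrt_hyp1F2:
  fixes a b c s :: real
  assumes a: "a > 0" and b: "b > 0" and c: "c > 0" and lt: "c < a + (b + 1/2)" and s: "s > 1"
  shows "of_real (\<integral>r. indicator {0<..} r * (r powr (b - 1) * hyp1F2 a b c (- r)) * exp (- s * (2 * sqrt r)) \<partial>lborel) =
     2 * of_real (Gamma (2 * b) * (2 * s) powr (- 2 * b)) * hyp2F1 a (b + 1/2) c (- 1 / of_real s ^ 2)"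
proof -
  define u where "u = (\<lambda>k. pochhammer a k / (fact k * pochhammer b k * pochhammer c k) * (-1) ^ k)"
  define v where "v = (\<lambda>k. pochhammer a k * pochhammer (b + 1/2) k / (fact k * pochhammer c k))"
  define K where "K = Gamma (2 * b) * (2 * s) powr (- 2 * b)"
  have pp: "pochhammer a k > 0" "pochhammer b k > 0" "pochhammer c k > 0" for k
    using a b c by (auto intro: pochhammer_pos)
  have abs_u: "\<bar>u k\<bar> = pochhammer a k / (fact k * pochhammer b k * pochhammer c k)" for k
    using pp[of k] by (simp add: u_def abs_mult)
  have g: "Gamma ((b + real k) / (1/2)) / (2 * s) powr ((b + real k) / (1/2)) =
      K * (pochhammer b k * pochhammer (b + 1/2) k * (1 / s\<^sup>2) ^ k)" for k
  proof -
    have e: "(b + real k) / (1/2) = 2 * b + real (2 * k)" by simp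
    have "Gamma (2 * b + real (2 * k)) = Gamma (2 * b) * (4 ^ k * pochhammer b k * pochhammer (b + 1/2) k)"
      using b by (simp only: Gamma_add_nat[of "2 * b"] pochhammer_double) (simp add: power_mult)
    moreover have "(2 * s) powr (2 * b + real (2 * k)) = (2 * s) powr (2 * b) * (4 ^ k * (s\<^sup>2) ^ k)"
    proof -
      have "(2 * s) powr real (2 * k) = (2 * s) ^ (2 * k)" using s by (intro powr_realpow) simp
      also have "\<dots> = 4 ^ k * (s\<^sup>2) ^ k" by (simp add: power_mult power_mult_distrib)
      finally show ?thesis by (simp only: powr_add)
    qed
    moreover have "(2 * s) powr (- 2 * b) = 1 / (2 * s) powr (2 * b)"
      using powr_minus_divide[of "2 * s" "2 * b"] by simp
    ultimately show ?thesis
      unfolding e K_def by (simp add: power_one_over)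
  qed
  have 1: "summable (\<lambda>k. \<bar>u k\<bar> * r ^ k)" if "r > 0" for r
    unfolding abs_u using summable_hyp1F2[OF a b c, of r] that by simp
  have s2: "0 \<le> 1 / s\<^sup>2" "1 / s\<^sup>2 < 1" using s by (auto simp: power2_eq_square less_1_mult)
  have "summable (\<lambda>k. K * (v k * (1 / s\<^sup>2) ^ k))"
    unfolding v_def using a b c lt s2 by (intro summable_mult summable_hyp2F1) auto
  also have "(\<lambda>k. K * (v k * (1 / s\<^sup>2) ^ k)) =
      (\<lambda>k. \<bar>u k\<bar> * (Gamma ((b + real k) / (1/2)) / (2 * s) powr ((b + real k) / (1/2))))"
    unfolding g abs_u v_def using pp(2) by (intro ext) (simp add: less_imp_neq[symmetric] mult_ac)
  finally have 2: "summable (\<lambda>k. \<bar>u k\<bar> * (Gamma ((b + real k) / (1/2)) / (2 * s) powr ((b + real k) / (1/2))))" .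
  have F: "(\<Sum>k. u k * r ^ k) = hyp1F2 a b c (- r)" for r
    unfolding hyp1F2_def u_def by (simp add: power_minus[of r] mult_ac)
  have w: "indicator {0<..} r * (r powr (b - 1) * exp (- (2 * s) * r powr (1/2))) * hyp1F2 a b c (- r) =
      indicator {0<..} r * (r powr (b - 1) * hyp1F2 a b c (- r)) * exp (- s * (2 * sqrt r))" for r :: real
    by (cases "r > 0") (auto simp: powr_half_sqrt mult_ac)
  have "2 * s > 0" "(1/2::real) > 0" using s by auto
  note mix = Gamma_mixture(2)[of b "2 * s" "1/2" u, OF b this 1 2, unfolded F w]
  have "u k * (Gamma ((b + real k) / (1/2)) / (1/2 * (2 * s) powr ((b + real k) / (1/2)))) =
      2 * K * (v k * (- 1 / s\<^sup>2) ^ k)" for k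
  proof -
    have "(- 1 / s\<^sup>2) ^ k = (-1) ^ k * (1 / s\<^sup>2) ^ k" by (simp flip: power_mult_distrib)
    moreover have "Gamma ((b + real k) / (1/2)) / (1/2 * (2 * s) powr ((b + real k) / (1/2))) =
        2 * (Gamma ((b + real k) / (1/2)) / (2 * s) powr ((b + real k) / (1/2)))"
      by simp
    ultimately show ?thesis
      unfolding g using pp(2)[of k] by (simp add: u_def v_def mult_ac)
  qed
  with mix have "(\<lambda>k. 2 * K * (v k * (- 1 / s\<^sup>2) ^ k)) sums
     (\<integral>r. indicator {0<..} r * (r powr (b - 1) * hyp1F2 a b c (- r)) * exp (- s * (2 * sqrt r)) \<partial>lborel)"
    by simp
  hence "(\<lambda>k. complex_of_real (2 * K * (v k * (- 1 / s\<^sup>2) ^ k))) sums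
     of_real (\<integral>r. indicator {0<..} r * (r powr (b - 1) * hyp1F2 a b c (- r)) * exp (- s * (2 * sqrt r)) \<partial>lborel)"
    by (rule sums_of_real)
  moreover have "complex_of_real (2 * K * (v k * (- 1 / s\<^sup>2) ^ k)) =
      2 * of_real K * (of_real (v k) * (- 1 / of_real s ^ 2) ^ k)" for k by simp
  moreover have "(\<lambda>k. 2 * of_real K * (of_real (v k) * (- 1 / of_real s ^ 2) ^ k)) sums
      (2 * of_real K * hyp2F1 a (b + 1/2) c (- 1 / of_real s ^ 2))"
    unfolding v_def using a b c lt s2(2)
    by (intro sums_mult hyp2F1_sums) (auto simp: norm_divide norm_power)
  ultimately have "of_real (\<integral>r. indicator {0<..} r * (r powr (b - 1) * hyp1F2 a b c (- r)) * exp (- s * (2 * sqrt r)) \<partial>lborel) =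
      2 * of_real K * hyp2F1 a (b + 1/2) c (- 1 / of_real s ^ 2)"
    by (metis (no_types, lifting) sums_unique2 sums_cong)
  thus ?thesis unfolding K_def .
qed

text \<open>The set is the image under exp of the convex half-strip Re z > 0, |Im z| < pi/2. It is
  the domain for the analytic continuation off the real ray.\<close>

lemma connected_right_half_plane_minus_disc:
  "connected {s. Re s > 0 \<and> norm s > 1}"
proof -
  define B where "B = {z. Re z > 0} \<inter> {z. Im z < pi / 2} \<inter> {z. Im z > - (pi / 2)}"
  have "convex B" unfolding B_def
    by (intro convex_Int convex_halfspace_Re_gt convex_halfspace_Im_lt convex_halfspace_Im_gt)
  hence "connected (exp ` B)"
    by (intro connected_continuous_image convex_connected continuous_intros)
  also have "exp ` B = {s. Re s > 0 \<and> norm s > 1}"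
  proof safe
    fix z assume "z \<in> B"
    hence z: "Re z > 0" "\<bar>Im z\<bar> < pi / 2" by (auto simp: B_def)
    have "cos (Im z) > 0" using z(2) by (intro cos_gt_zero_pi) auto
    thus "Re (exp z) > 0" "norm (exp z) > 1" using z(1) by (simp_all add: Re_exp)
  next
    fix s :: complex assume s: "Re s > 0" "norm s > 1"
    hence "s \<noteq> 0" by auto
    hence "Ln s \<in> B" using s Re_Ln_pos_lt[of s] by (auto simp: B_def)
    moreover have "s = exp (Ln s)" using \<open>s \<noteq> 0\<close> by simp
    ultimately show "s \<in> exp ` B" by blast
  qed
  finally show ?thesis .
qed

text \<open>The order c <= b loses nothing by symmetry. With a < c it gives q < b for every q < a,
  so that these moments are available, and also c < a + b + 1/2, so that the 2F1 has a genuine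
  singularity at 1.\<close>

lemma hyp1F2_negative_if_sum_less:
  fixes a b c :: real
  assumes a: "a > 0" and ac: "a < c" and cb: "c \<le> b" and sum: "b + c < 3 * a + 1/2"
  shows "\<exists>r>0. hyp1F2 a b c (- r) < 0"
proof (rule ccontr)
  assume "\<not> ?thesis"
  hence F: "hyp1F2 a b c (- r) \<ge> 0" if "r > 0" for r using that by force
  have b: "b > 0" and c: "c > 0" using a ac cb by auto
  have [measurable]: "hyp1F2 a b c \<in> borel_measurable borel"
    using a b c by (rule borel_measurable_hyp1F2)
  define \<beta> \<gamma> where "\<beta> = b + 1/2" and "\<gamma> = a + \<beta> - c"
  have \<beta>: "\<beta> > 0" and lt: "c < a + \<beta>" using a b cb by (auto simp: \<beta>_def)
  \<comment> \<open>Since b + c < 3 a + 1/2, the bound (b + c - a - 1/2) / 2 lies below a. Taking q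
    strictly between it and a keeps the moment finite and makes 2 l < \<gamma>, which is what
    clashes with the singularity.\<close>
  define q0 where "q0 = max 0 ((b + c - a - 1/2) / 2)"
  have q0: "0 \<le> q0" "q0 < a" "(b + c - a - 1/2) / 2 \<le> q0" using a sum by (auto simp: q0_def)
  define q where "q = (q0 + a) / 2"
  have q: "0 < q" "q < a" "q < b" "b + c < a + 2 * q + 1/2"
    using a ac cb q0 by (auto simp: q_def field_simps)
  define l where "l = b - q"
  have l: "l > 0" using q by (simp add: l_def)
  have l\<gamma>: "2 * l < \<gamma>" using q by (simp add: l_def \<gamma>_def \<beta>_def)
  have \<gamma>: "\<gamma> > 0" using l l\<gamma> by simp
  define f where "f = (\<lambda>r. indicator {0<..} r * (r powr (q - 1) * hyp1F2 a b c (- r)))"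
  have f_int: "integrable lborel f"
    unfolding f_def using a b ac q(1,2,3) F by (rule integrable_hyp1F2_moment)
  define A where "A = (\<lambda>r. indicator {0<..} r * (r powr (b - 1) * hyp1F2 a b c (- r)))"
  \<comment> \<open>The absolute value keeps \<phi> nonnegative on the whole line, as
    \<open>sqrt\<close> is negative at negative arguments; A vanishes there anyway.\<close>
  define \<phi> where "\<phi> = (\<lambda>r::real. 2 * sqrt \<bar>r\<bar>)"
  have [measurable]: "A \<in> borel_measurable borel" "\<phi> \<in> borel_measurable borel"
    unfolding A_def \<phi>_def by measurable
  have A0: "A r \<ge> 0" for r using F[of r] by (cases "r > 0") (auto simp: A_def)
  have f0: "f r \<ge> 0" for r using F[of r] by (cases "r > 0") (auto simp: f_def)
  have \<phi>0: "\<phi> r \<ge> 0" for r by (simp add: \<phi>_def)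
  define D where "D = exp ((2 * l) * ln (2 * l) - 2 * l)"
  have D: "D > 0" by (simp add: D_def)
  \<comment> \<open>The exponent 2 l turns the square root into r^(-l), and this factor lowers
    r^(b-1) to r^(q-1), the integrand of the finite moment.\<close>
  have le: "A r * exp (- \<sigma> * \<phi> r) \<le> D * (2 * \<sigma>) powr (- 2 * l) * f r" if \<sigma>: "\<sigma> > 0" for r \<sigma>
  proof (cases "r > 0")
    case True
    have "exp (- (\<sigma> * \<phi> r)) \<le> D * (\<sigma> * \<phi> r) powr (- (2 * l))"
      unfolding D_def using l True \<sigma> by (intro exp_minus_le_powr) (auto simp: \<phi>_def)
    also have "(\<sigma> * \<phi> r) powr (- (2 * l)) = (2 * \<sigma>) powr (- (2 * l)) * r powr (- l)"
    proof -
      have "\<sigma> * \<phi> r = (2 * \<sigma>) * r powr (1/2)" using True by (simp add: \<phi>_def powr_half_sqrt)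
      thus ?thesis by (simp only: powr_mult powr_powr) simp
    qed
    finally have "A r * exp (- (\<sigma> * \<phi> r)) \<le> A r * (D * ((2 * \<sigma>) powr (- (2 * l)) * r powr (- l)))"
      using A0[of r] by (intro mult_left_mono)
    also have "\<dots> = D * (2 * \<sigma>) powr (- (2 * l)) * (A r * r powr (- l))" by simp
    also have "A r * r powr (- l) = f r"
    proof -
      have "q - 1 = (b - 1) + - l" by (simp add: l_def)
      hence "r powr (q - 1) = r powr (b - 1) * r powr (- l)" by (simp only: powr_add)
      thus ?thesis by (simp add: A_def f_def)
    qed
    finally show ?thesis by simp
  qed (simp add: A_def f_def)
  have A_int: "integrable lborel (\<lambda>r. A r * exp (- \<sigma> * \<phi> r))" if \<sigma>: "\<sigma> > 0" for \<sigma>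
  proof (rule Bochner_Integration.integrable_bound)
    show "integrable lborel (\<lambda>r. D * (2 * \<sigma>) powr (- 2 * l) * f r)" using f_int by simp
    show "AE r in lborel. norm (A r * exp (- \<sigma> * \<phi> r)) \<le> norm (D * (2 * \<sigma>) powr (- 2 * l) * f r)"
      using le[OF \<sigma>] A0 f0 D by (intro AE_I2) (simp add: abs_mult)
  qed measurable
  define L where "L = (\<lambda>s. \<integral>r. of_real (A r) * exp (- s * of_real (\<phi> r)) \<partial>lborel :: complex)"
  define M where "M = (\<integral>r. f r \<partial>lborel)"
  have M: "M \<ge> 0" unfolding M_def using f0 by (intro integral_nonneg_AE) auto
  have L_le: "norm (L s) \<le> D * M * (2 * Re s) powr (- 2 * l)" if s: "Re s > 0" for s
  proof -
    have "norm (L s) \<le> (\<integral>r. norm (of_real (A r) * exp (- s * of_real (\<phi> r))) \<partial>lborel)"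
      unfolding L_def by (rule integral_norm_bound)
    also have "\<dots> = (\<integral>r. A r * exp (- Re s * \<phi> r) \<partial>lborel)"
      using A0 by (intro Bochner_Integration.integral_cong) (auto simp: norm_mult norm_exp_eq_Re)
    also have "\<dots> \<le> (\<integral>r. D * (2 * Re s) powr (- 2 * l) * f r \<partial>lborel)"
      using A_int[OF s] f_int le[OF s] by (intro integral_mono) auto
    also have "\<dots> = D * M * (2 * Re s) powr (- 2 * l)" by (simp add: M_def)
    finally show ?thesis .
  qed
  have L_holo: "L holomorphic_on {s. Re s > 0}"
    unfolding L_def by (rule Laplace_transform_holomorphic) (use A0 \<phi>0 A_int in auto)
  \<comment> \<open>On \<open>S\<close> one has |-1/s^2| < 1, so the closed form \<open>R\<close>
    converges. It agrees with \<open>L\<close> on the real ray s > 1, hence on all of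
    \<open>S\<close> by the identity theorem; \<open>L\<close> is bounded by \<open>L_le\<close> up
    to the point \<i> on the boundary of \<open>S\<close>.\<close>
  define S where "S = {s. Re s > 0 \<and> norm s > 1}"
  define R where "R = (\<lambda>s. 2 * of_real (Gamma (2 * b)) * (2 * s) powr (of_real (- 2 * b)) *
      hyp2F1 a \<beta> c (- 1 / s ^ 2))"
  have S_pos: "2 * s \<notin> \<real>\<^sub>\<le>\<^sub>0" "s \<noteq> 0" "- 1 / s ^ 2 \<in> ball 0 1" if "s \<in> S" for s
  proof -
    have "1 < (norm s)\<^sup>2" using that by (intro one_less_power) (auto simp: S_def)
    thus "- 1 / s ^ 2 \<in> ball 0 1" by (simp add: norm_divide norm_power divide_less_eq)
  qed (use that in \<open>auto simp: S_def complex_nonpos_Reals_iff\<close>)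
  have R_holo: "R holomorphic_on S"
  proof -
    have "(hyp2F1 a \<beta> c \<circ> (\<lambda>s. - 1 / s ^ 2)) holomorphic_on S"
      by (rule holomorphic_on_compose_gen[OF _ hyp2F1_holomorphic[OF a \<beta> c lt]])
         (use S_pos in \<open>auto intro!: holomorphic_intros\<close>)
    hence "(\<lambda>s. hyp2F1 a \<beta> c (- 1 / s ^ 2)) holomorphic_on S" by (simp add: o_def)
    thus ?thesis unfolding R_def using S_pos by (intro holomorphic_intros) auto
  qed
  have real_eq: "L (of_real s) - R (of_real s) = 0" if s: "s > 1" for s
  proof -
    have "L (of_real s) = of_real (\<integral>r. A r * exp (- s * \<phi> r) \<partial>lborel)"
      unfolding L_def integral_complex_of_real[symmetric] by (simp add: exp_of_real[symmetric])
    also have "(\<integral>r. A r * exp (- s * \<phi> r) \<partial>lborel) =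
        (\<integral>r. indicator {0<..} r * (r powr (b - 1) * hyp1F2 a b c (- r)) * exp (- s * (2 * sqrt r)) \<partial>lborel)"
      by (intro Bochner_Integration.integral_cong) (auto simp: A_def \<phi>_def indicator_def)
    also have "of_real \<dots> = 2 * of_real (Gamma (2 * b) * (2 * s) powr (- 2 * b)) * hyp2F1 a \<beta> c (- 1 / of_real s ^ 2)"
      unfolding \<beta>_def using a b c lt[unfolded \<beta>_def] s by (rule Laplace_sqrt_hyp1F2)
    also have "\<dots> = R (of_real s)"
    proof -
      have "(2 * complex_of_real s) powr (of_real (- 2 * b)) = of_real ((2 * s) powr (- 2 * b))"
        using s powr_of_real[of "2 * s" "- 2 * b"] by simp
      thus ?thesis unfolding R_def by simp
    qed
    finally show ?thesis by simp
  qed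
  have LR: "L s = R s" if s: "s \<in> S" for s
  proof -
    have "L s - R s = 0"
    proof (rule analytic_continuation[where f = "\<lambda>s. L s - R s" and S = S and U = "of_real ` {1<..}" and \<xi> = 2])
      show "(\<lambda>s. L s - R s) holomorphic_on S"
        using R_holo holomorphic_on_subset[OF L_holo, of S]
        by (intro holomorphic_intros) (auto simp: S_def)
      have "S = {s. Re s > 0} \<inter> {s. norm s > 1}" by (auto simp: S_def)
      thus "open S" by (simp add: open_Int open_halfspace_Re_gt open_Collect_less continuous_intros)
      show "connected S" unfolding S_def by (rule connected_right_half_plane_minus_disc)
      show "of_real ` {1<..} \<subseteq> S" "2 \<in> S" by (auto simp: S_def)
      show "(2::complex) islimpt of_real ` {1<..}"
        unfolding islimpt_approachable
      proof (intro allI impI)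
        fix e :: real assume "e > 0"
        thus "\<exists>x'\<in>of_real ` {1<..}. x' \<noteq> 2 \<and> dist x' (2::complex) < e"
          by (intro bexI[of _ "of_real (2 + e / 2)"] imageI) (auto simp: dist_norm)
      qed
    qed (use real_eq s in auto)
    thus ?thesis by simp
  qed
  obtain \<kappa> C where \<kappa>: "\<kappa> > 0" "C \<ge> 0" and
    lower: "\<And>w. norm w < 1 \<Longrightarrow> norm (1 - w) \<le> 2 * (1 - norm w) \<Longrightarrow>
       norm (hyp2F1 a \<beta> c w) \<ge> \<kappa> * norm (1 - w) powr (- \<gamma>) - C"
    using hyp2F1_lower_bound[OF a \<beta> c lt] unfolding \<gamma>_def by metis
  \<comment> \<open>On the path chosen below |2 s| <= 6, so \<open>P\<close> bounds the prefactor of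
    \<open>R\<close> from below; the other power of 6 comes from |1 - w| <= 6 \<sigma>.
    \<open>K2\<close> collects the additive error of the lower bound and the upper bound for
    \<open>L\<close>.\<close>
  define P where "P = 2 * Gamma (2 * b) * 6 powr (- 2 * b)"
  have P: "P > 0" using b by (simp add: P_def Gamma_real_pos)
  define K1 K2 where "K1 = P * \<kappa> * 6 powr (- \<gamma>)" and "K2 = P * C + D * M * 2 powr (- 2 * l)"
  have K: "K1 > 0" "K2 \<ge> 0" using P \<kappa> D M by (auto simp: K1_def K2_def)
  have main: "K1 \<le> K2 * \<sigma> powr (\<gamma> - 2 * l)" if \<sigma>: "0 < \<sigma>" "\<sigma> \<le> 1" for \<sigma>
  proof -
    \<comment> \<open>As \<open>\<sigma>\<close> tends to \<open>0\<close>, \<open>s\<close> tends to the singularity \<open>\<i>\<close> while \<open>w\<close> tends to \<open>1\<close> inside a cone;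
      on the line \<open>Im s = 1\<close> the approach of \<open>w\<close> would be tangential.\<close>
    define s where "s = Complex \<sigma> (1 + \<sigma>)"
    define w where "w = - 1 / s ^ 2"
    have n2: "(norm s)\<^sup>2 = 1 + 2 * \<sigma> + 2 * \<sigma>\<^sup>2"
      unfolding cmod_power2 by (simp add: s_def power2_eq_square algebra_simps)
    have n1: "(norm s)\<^sup>2 > 1" using n2 \<sigma> by (simp add: add_pos_pos)
    have ns: "norm s > 1"
      using n1 power_less_imp_less_base[of 1 2 "norm s"] by simp
    have s: "s \<in> S" using \<sigma> ns by (simp add: S_def s_def)
    have s0: "s \<noteq> 0" using ns by auto
    have nw: "norm w = 1 / (norm s)\<^sup>2" by (simp add: w_def norm_divide norm_power)
    have w1: "norm w < 1" unfolding nw using n1 by (simp add: divide_less_eq)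
    have "s ^ 2 + 1 = Complex (- 2 * \<sigma>) (2 * \<sigma> * (1 + \<sigma>))"
      by (simp add: s_def complex_eq_iff power2_eq_square algebra_simps)
    hence "norm (s ^ 2 + 1) \<le> 2 * \<sigma> + 2 * \<sigma> * (1 + \<sigma>)"
      using cmod_le[of "s ^ 2 + 1"] \<sigma> by simp
    moreover have "1 - w = (s ^ 2 + 1) / s ^ 2" using s0 by (simp add: w_def field_simps)
    ultimately have "norm (1 - w) * (norm s)\<^sup>2 \<le> 2 * \<sigma> + 2 * \<sigma> * (1 + \<sigma>)"
      using s0 by (simp add: norm_divide norm_power)
    hence n1w: "norm (1 - w) * (norm s)\<^sup>2 \<le> 4 * \<sigma> + 2 * \<sigma>\<^sup>2"
      by (simp add: power2_eq_square algebra_simps)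
    \<comment> \<open>The right side times |s|^2 is 2 (|s|^2 - 1) = 4 \<sigma> + 4 \<sigma>^2, which
      exceeds the bound \<open>n1w\<close>.\<close>
    have cone: "norm (1 - w) \<le> 2 * (1 - norm w)"
    proof -
      have "2 * (1 - norm w) * (norm s)\<^sup>2 = 2 * (norm s)\<^sup>2 - 2"
        unfolding nw using s0 by (simp add: left_diff_distrib right_diff_distrib)
      hence "norm (1 - w) * (norm s)\<^sup>2 \<le> 2 * (1 - norm w) * (norm s)\<^sup>2"
        using n1w n2 zero_le_power2[of \<sigma>] by linarith
      thus ?thesis by (rule mult_right_le_imp_le) (use n1 in linarith)
    qed
    have "norm (1 - w) * 1 \<le> norm (1 - w) * (norm s)\<^sup>2"
      using n1 by (intro mult_left_mono) auto
    moreover have "\<sigma>\<^sup>2 \<le> \<sigma>" using \<sigma> by (simp add: power2_eq_square mult_left_le)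
    ultimately have small: "norm (1 - w) \<le> 6 * \<sigma>" using n1w by linarith
    have pos1: "norm (1 - w) > 0" using w1 by auto
    have "\<sigma> powr (- \<gamma>) * (\<kappa> * 6 powr (- \<gamma>)) - C = \<kappa> * (6 * \<sigma>) powr (- \<gamma>) - C"
      by (simp add: powr_mult)
    also have "\<dots> \<le> \<kappa> * norm (1 - w) powr (- \<gamma>) - C"
      using small pos1 \<kappa> \<gamma> by (intro diff_mono mult_left_mono powr_mono2') auto
    also have "\<dots> \<le> norm (hyp2F1 a \<beta> c w)" by (rule lower[OF w1 cone])
    finally have low: "\<sigma> powr (- \<gamma>) * (\<kappa> * 6 powr (- \<gamma>)) - C \<le> norm (hyp2F1 a \<beta> c w)" .
    have "norm s \<le> \<bar>Re s\<bar> + \<bar>Im s\<bar>" by (rule cmod_le)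
    hence "norm (2 * s) \<le> 6" using \<sigma> by (simp add: s_def norm_mult)
    hence "6 powr (- 2 * b) \<le> norm (2 * s) powr (- 2 * b)"
      using b s0 by (intro powr_mono2') auto
    hence "P \<le> 2 * Gamma (2 * b) * norm (2 * s) powr (- 2 * b)"
      unfolding P_def using b Gamma_real_pos[of "2 * b"] by (intro mult_left_mono) auto
    hence "P * norm (hyp2F1 a \<beta> c w) \<le> 2 * Gamma (2 * b) * norm (2 * s) powr (- 2 * b) * norm (hyp2F1 a \<beta> c w)"
      by (intro mult_right_mono) auto
    also have "\<dots> = norm (R s)"
      using b Gamma_real_pos[of "2 * b"] norm_powr_real_powr'[of "complex_of_real (- 2 * b)" "2 * s"]
      unfolding R_def w_def by (simp add: norm_mult)
    also have "\<dots> = norm (L s)" using LR[OF s] by simp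
    also have "\<dots> \<le> D * M * (2 * \<sigma>) powr (- 2 * l)" using L_le[of s] \<sigma> by (simp add: s_def)
    also have "\<dots> = D * M * 2 powr (- 2 * l) * \<sigma> powr (- 2 * l)" by (simp add: powr_mult)
    finally have up: "P * norm (hyp2F1 a \<beta> c w) \<le> D * M * 2 powr (- 2 * l) * \<sigma> powr (- 2 * l)" .
    have "P * (\<sigma> powr (- \<gamma>) * (\<kappa> * 6 powr (- \<gamma>)) - C) \<le> P * norm (hyp2F1 a \<beta> c w)"
      using low P by (intro mult_left_mono) auto
    hence "K1 * \<sigma> powr (- \<gamma>) \<le> P * C * 1 + D * M * 2 powr (- 2 * l) * \<sigma> powr (- 2 * l)"
      using up by (simp add: K1_def algebra_simps)
    also have "\<dots> \<le> P * C * \<sigma> powr (- 2 * l) + D * M * 2 powr (- 2 * l) * \<sigma> powr (- 2 * l)"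
    proof -
      have "1 powr (- 2 * l) \<le> \<sigma> powr (- 2 * l)" using \<sigma> l by (intro powr_mono2') auto
      thus ?thesis using P \<kappa> D M by (intro add_mono mult_left_mono) auto
    qed
    also have "\<dots> = K2 * \<sigma> powr (- 2 * l)" by (simp add: K2_def distrib_right)
    finally have "K1 * \<sigma> powr (- \<gamma>) * \<sigma> powr \<gamma> \<le> K2 * \<sigma> powr (- 2 * l) * \<sigma> powr \<gamma>"
      by (intro mult_right_mono) auto
    also have "K2 * \<sigma> powr (- 2 * l) * \<sigma> powr \<gamma> = K2 * \<sigma> powr (\<gamma> - 2 * l)"
      by (simp add: mult.assoc flip: powr_add)
    also have "K1 * \<sigma> powr (- \<gamma>) * \<sigma> powr \<gamma> = K1" using \<sigma> by (simp add: mult.assoc flip: powr_add)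
    finally show ?thesis .
  qed
  define \<eta> where "\<eta> = \<gamma> - 2 * l"
  have \<eta>: "\<eta> > 0" using l\<gamma> by (simp add: \<eta>_def)
  \<comment> \<open>Taking \<sigma> = t^(1/\<eta>) in \<open>main\<close> gives K1 <= K2 t, while t
    is chosen so that K2 t <= K1 / 2.\<close>
  define t where "t = min 1 (K1 / (2 * (K2 + 1)))"
  have t: "0 < t" "t \<le> 1" "t \<le> K1 / (2 * (K2 + 1))" using K by (auto simp: t_def)
  have "t powr (1 / \<eta>) \<le> 1" using t \<eta> by (intro powr_le1) auto
  hence "K1 \<le> K2 * (t powr (1 / \<eta>)) powr \<eta>"
    unfolding \<eta>_def[symmetric] using main[of "t powr (1 / \<eta>)"] t unfolding \<eta>_def by simp
  also have "(t powr (1 / \<eta>)) powr \<eta> = t" using t \<eta> by (simp add: powr_powr)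
  also have "K2 * t \<le> (K2 + 1) * (K1 / (2 * (K2 + 1)))"
    using t K by (intro mult_mono) auto
  also have "\<dots> = K1 / 2" using K by (simp add: field_simps)
  finally show False using K by simp
qed

text \<open>The union of \<open>newton_diagram (Lam a)\<close> and \<open>Oset a\<close> is exactly
  the region b > a, c > a, b + c >= 3 a + 1/2: the pieces of \<open>Oset a\<close> are the points of
  this region with a coordinate below min (a + 1/2) (2 a). Outside it, one of the two negativity
  results applies after ordering b and c.\<close>

lemma hyp1F2_Nset_negative:
  fixes a b c :: real
  assumes a: "a > 0" and N: "(b, c) \<in> Nset a"
  shows "\<exists>r>0. hyp1F2 a b c (- r) < 0"
proof -
  have b: "b > 0" and c: "c > 0" using N by (auto simp: Nset_def)
  have "b \<le> a \<or> c \<le> a \<or> b + c < 3 * a + 1/2"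
    using N a unfolding Nset_def newton_diagram_Lam Oset_def by (auto split: if_splits)
  then consider "c \<le> a" | "b \<le> a" | "a < b" "a < c" "b + c < 3 * a + 1/2" by linarith
  thus ?thesis
  proof cases
    case 1
    thus ?thesis using hyp1F2_negative_if_le[OF a b c] by blast
  next
    case 2
    thus ?thesis using hyp1F2_negative_if_le[OF a c b] by (simp add: hyp1F2_commute[of a c b])
  next
    case 3
    show ?thesis
    proof (cases "c \<le> b")
      case True
      thus ?thesis using hyp1F2_negative_if_sum_less[OF a] 3 by simp
    next
      case False
      thus ?thesis using hyp1F2_negative_if_sum_less[OF a, of b c] 3
        by (simp add: hyp1F2_commute[of a c b])
    qed
  qed
qed

section \<open>From the sign of 1F2 at -r to signs and zeros in x\<close>

theorem theorem6:
  fixes a b c :: real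
  assumes "a > 0" and "b > 0" and "c > 0"
  shows "((b, c) \<in> newton_diagram (Lam a) \<longrightarrow>
            (\<forall>x>0. hyp1F2 a b c (- (x^2) / 4) \<ge> 0) \<and>
            ((b, c) \<notin> Lam a \<longrightarrow> (\<forall>x>0. hyp1F2 a b c (- (x^2) / 4) > 0)))
       \<and> ((b, c) \<in> Nset a \<longrightarrow>
            (\<exists>x>0. hyp1F2 a b c (- (x^2) / 4) > 0) \<and>
            (\<exists>x>0. hyp1F2 a b c (- (x^2) / 4) < 0) \<and>
            (\<exists>x>0. hyp1F2 a b c (- (x^2) / 4) = 0))"
proof (intro conjI impI allI)
  fix x :: real assume "x > 0"
  hence r: "x\<^sup>2 / 4 > 0" by simp
  have eq: "- (x\<^sup>2) / 4 = - (x\<^sup>2 / 4)" by simp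
  show "(b, c) \<in> newton_diagram (Lam a) \<Longrightarrow> hyp1F2 a b c (- (x\<^sup>2) / 4) \<ge> 0"
    unfolding eq using hyp1F2_newton_diagram(1)[OF assms(1) _ r] by blast
  show "(b, c) \<in> newton_diagram (Lam a) \<Longrightarrow> (b, c) \<notin> Lam a \<Longrightarrow> hyp1F2 a b c (- (x\<^sup>2) / 4) > 0"
    unfolding eq using hyp1F2_newton_diagram(2)[OF assms(1) _ r] by blast
next
  assume N: "(b, c) \<in> Nset a"
  define \<Phi> where "\<Phi> = (\<lambda>x. hyp1F2 a b c (- (x^2) / 4))"
  have cont: "continuous_on A \<Phi>" for A
    unfolding \<Phi>_def
    by (rule continuous_on_compose2[OF continuous_hyp1F2[OF assms, of UNIV]])
       (auto intro!: continuous_intros)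
  obtain r where r: "r > 0" "hyp1F2 a b c (- r) < 0"
    using hyp1F2_Nset_negative[OF assms(1) N] by blast
  define X where "X = 2 * sqrt r"
  have X: "X > 0" "\<Phi> X < 0" using r by (auto simp: X_def \<Phi>_def power_mult_distrib)
  have "(\<Phi> \<longlongrightarrow> \<Phi> 0) (at 0)"
    using cont[of UNIV] by (simp add: continuous_on_eq_continuous_at isCont_def)
  hence "\<forall>\<^sub>F y in at 0. \<Phi> y > 0" by (rule order_tendstoD(1)) (simp add: \<Phi>_def)
  then obtain e where e: "e > 0" "\<And>y. y \<noteq> 0 \<Longrightarrow> dist y 0 < e \<Longrightarrow> \<Phi> y > 0"
    unfolding eventually_at by blast
  \<comment> \<open>\<open>Y\<close> is close enough to 0 for positivity, which holds there because
    \<Phi> 0 = 1, and lies to the left of \<open>X\<close>, so the zero between them is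
    positive.\<close>
  define Y where "Y = min (e / 2) (X / 2)"
  have Y: "Y > 0" "Y \<le> X" "\<Phi> Y > 0" using e X by (auto simp: Y_def)
  obtain Z where Z: "Y \<le> Z" "Z \<le> X" "\<Phi> Z = 0"
    using IVT2'[of \<Phi> X 0 Y] X Y cont by auto
  show "\<exists>x>0. hyp1F2 a b c (- (x^2) / 4) > 0" using Y unfolding \<Phi>_def by blast
  show "\<exists>x>0. hyp1F2 a b c (- (x^2) / 4) < 0" using X unfolding \<Phi>_def by blast
  have "Z > 0" using Z Y by linarith
  thus "\<exists>x>0. hyp1F2 a b c (- (x^2) / 4) = 0" using Z(3) unfolding \<Phi>_def by blast
qed

end
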